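(* Assume $\mathcal H_\delta(U,V)$ (defined in the context) is satisfied for some $\delta\in(0,1]$. Assume in addition that there are semi-metrics $\varrho_\varphi$ on $\mathbb X$ and $\varrho_\psi$ on $\mathbb Y$ such that for all $x_1,x_2\in\mathbb X$, $y_1,y_2\in\mathbb Y$ $$e^{\delta U(x_1)}+e^{\delta U(x_2)}\ge\varrho_\varphi(x_1,x_2),\qquad e^{\delta V(y_1)}+e^{\delta V(y_2)}\ge\varrho_\psi(y_1,y_2).$$ Let $(\varphi,\psi)=(e^{\delta(U-U_\star)},e^{\delta(V-V_\star)})$ with $U_\star=\inf U$, $V_\star=\inf V$. Then there exist $n_0\ge1$, $\rho\in[0,1)$ and $c_u,c_v\ge0$ such that for any $n\ge n_0$ $$\mathbb W_{\varrho_\psi}(\pi_{2n},\nu_V)\le c_v\,\rho^{n-n_0}|||\pi_{2n_0}-\nu_V|||_\psi,\qquad\mathbb W_{\varrho_\varphi}(\pi_{2n+1},\lambda_U)\le c_u\,\rho^{n-n_0}|||\pi_{2n_0+1}-\lambda_U|||_\varphi.$$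
   Context: Setting. $(\mathbb X,\lambda)$ and $(\mathbb Y,\nu)$ are locally compact Polish spaces with positive measures $\lambda,\nu$ that are finite on compact sets. $U:\mathbb X\to\mathbb R$, $V:\mathbb Y\to\mathbb R$, $W:\mathbb X\times\mathbb Y\to\mathbb R$ are measurable, such that $\lambda_U(dx):=e^{-U(x)}\lambda(dx)$ and $\nu_V(dy):=e^{-V(y)}\nu(dy)$ are probability measures and $Q(x,dy):=e^{-W(x,y)}\nu(dy)$ is a Markov kernel; more generally $\lambda_F(dx)=e^{-F(x)}\lambda(dx)$, $\nu_G(dy)=e^{-G(y)}\nu(dy)$. Put $R(y,dx):=e^{-W(x,y)}\lambda(dx)$. Integrated costs: $W_U(y)=\int\lambda_U(dx)W(x,y)$, $W^V(x)=\int\nu_V(dy)W(x,y)$. For a kernel $K$, $K(f)(x)=\int K(x,dy)f(y)$ and $(\mu K)(dy)=\int\mu(dx)K(x,dy)$. Standing assumption: some probability measure with marginals $\lambda_U,\nu_V$ has finite relative entropy with respect to $\lambda_U(dx)Q(x,dy)$. Standing regularity: $U,V,W$ are locally bounded (bounded on compact sets), $e^{-W}\in L_\infty(\lambda\otimes\nu)$, and $U,V$ have compact sub-level sets. Condition $\mathcal H_\delta(U,V)$: the functions $\mathcal U_\delta=\delta U-W^V$ and $\mathcal V_\delta=\delta V-W_U$ are locally bounded with compact sub-level sets, and $\lambda_{(1-\delta)U}(e^{W^V})\vee\nu_{(1-\delta)V}(e^{W_U})<\infty$. Sinkhorn iterations. $U_0=U$, $V_0=0$, and for $n\ge0$: $U_{2n+1}=U_{2n}=U+\log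 Q(e^{-V_{2n}})$, $V_{2(n+1)}=V_{2n+1}=V+\log R(e^{-U_{2n}})$; $$S_{2n}(x,dy)=\frac{Q(x,dy)e^{-V_{2n}(y)}}{Q(e^{-V_{2n}})(x)},\qquad S_{2n+1}(y,dx)=\frac{R(y,dx)e^{-U_{2n+1}(x)}}{R(e^{-U_{2n+1}})(y)};$$ $\pi_{2n}=\lambda_US_{2n}$, $\pi_{2n+1}=\nu_VS_{2n+1}$. $|||\mu|||_\theta=\int\theta\,d|\mu|$. A semi-metric is a nonnegative measurable symmetric function vanishing exactly on the diagonal; $\mathbb W_\varrho(\mu_1,\mu_2)=\inf\int\varrho\,dP$ over couplings $P$ of $\mu_1$ and $\mu_2$. *)

theory Defs
  imports "HOL-Probability.Probability"
begin

definition locally_bounded :: "('a::topological_space \<Rightarrow> real) \<Rightarrow> bool" where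
  "locally_bounded f \<longleftrightarrow> (\<forall>K. compact K \<longrightarrow> bounded (f ` K))"

definition compact_sublevels :: "('a::topological_space \<Rightarrow> real) \<Rightarrow> bool" where
  "compact_sublevels f \<longleftrightarrow> (\<forall>r. compact {x. f x \<le> r})"


section \<open>Kernels, couplings and relative entropy\<close>

definition gibbs :: "'a measure \<Rightarrow> ('a \<Rightarrow> real) \<Rightarrow> 'a measure" where
  "gibbs lam F = density lam (\<lambda>x. ennreal (exp (- F x)))"

definition kernel_Q :: "'b measure \<Rightarrow> ('a \<Rightarrow> 'b \<Rightarrow> real) \<Rightarrow> 'a \<Rightarrow> 'b measure" where
  "kernel_Q nu W x = density nu (\<lambda>y. ennreal (exp (- W x y)))"

definition kernel_R :: "'a measure \<Rightarrow> ('a \<Rightarrow> 'b \<Rightarrow> real) \<Rightarrow> 'b \<Rightarrow> 'a measure" where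
  "kernel_R lam W y = density lam (\<lambda>x. ennreal (exp (- W x y)))"

definition kernel_apply :: "('a \<Rightarrow> 'b measure) \<Rightarrow> ('b \<Rightarrow> real) \<Rightarrow> 'a \<Rightarrow> real" where
  "kernel_apply K f x = (\<integral>y. f y \<partial>K x)"

text \<open>The measure \<open>\<mu>(dx) K(x,dy)\<close> on the product space; \<open>\<mu> K\<close> itself is \<open>\<mu> \<bind> K\<close>.\<close>

definition joint :: "'a measure \<Rightarrow> 'b measure \<Rightarrow> ('a \<Rightarrow> 'b measure) \<Rightarrow> ('a \<times> 'b) measure" where
  "joint \<mu> N K = \<mu> \<bind> (\<lambda>x. distr (K x) (\<mu> \<Otimes>\<^sub>M N) (Pair x))"

definition couplings :: "'a measure \<Rightarrow> 'b measure \<Rightarrow> ('a \<times> 'b) measure set" where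
  "couplings M N =
    {P \<in> space (prob_algebra (M \<Otimes>\<^sub>M N)). distr P M fst = M \<and> distr P N snd = N}"

text \<open>The relative entropy of \<open>P\<close> with respect to a probability measure \<open>P0\<close> is
  \<open>\<integral> log (dP/dP0) dP\<close> if \<open>P \<lless> P0\<close> and infinite otherwise.  The negative part of the
  integrand is always integrable, so that finiteness is integrability.  The library's
  \<open>KL_divergence\<close> is a Bochner integral, whose value alone does not show finiteness.\<close>

definition finite_relative_entropy :: "'a measure \<Rightarrow> 'a measure \<Rightarrow> bool" where
  "finite_relative_entropy P P0 \<longleftrightarrow>
     absolutely_continuous P0 P \<and> integrable P (entropy_density (exp 1) P0 P)"


section \<open>Weighted total variation and transport semi-distances\<close>

text \<open>The total variation measure of the signed measure \<open>M - N\<close>, for finite measures on the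
  same sigma-algebra: the supremum of \<open>\<Sum>\<bar>M E - N E\<bar>\<close> over finite measurable partitions.
  Lemma \<open>emeasure_tv_measure\<close> below shows that \<open>measure_of\<close> does not fall back to the null
  measure here.\<close>

definition tv_value :: "'a measure \<Rightarrow> 'a measure \<Rightarrow> 'a set \<Rightarrow> ennreal" where
  "tv_value M N A =
    (SUP P \<in> {P. finite P \<and> P \<subseteq> sets M \<and> disjoint P \<and> \<Union>P = A}.
       \<Sum>E\<in>P. ennreal \<bar>measure M E - measure N E\<bar>)"

definition tv_measure :: "'a measure \<Rightarrow> 'a measure \<Rightarrow> 'a measure" where
  "tv_measure M N = measure_of (space M) (sets M) (tv_value M N)"

definition tv_norm_diff :: "('a \<Rightarrow> real) \<Rightarrow> 'a measure \<Rightarrow> 'a measure \<Rightarrow> ennreal" where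
  "tv_norm_diff \<theta> M N = (\<integral>\<^sup>+x. ennreal (\<theta> x) \<partial>tv_measure M N)"

definition semi_metric :: "('a::topological_space \<Rightarrow> 'a \<Rightarrow> real) \<Rightarrow> bool" where
  "semi_metric r \<longleftrightarrow>
     case_prod r \<in> borel_measurable (borel \<Otimes>\<^sub>M borel) \<and>
     (\<forall>x y. 0 \<le> r x y) \<and> (\<forall>x y. r x y = r y x) \<and> (\<forall>x y. r x y = 0 \<longleftrightarrow> x = y)"

definition transport :: "('a \<Rightarrow> 'a \<Rightarrow> real) \<Rightarrow> 'a measure \<Rightarrow> 'a measure \<Rightarrow> ennreal" where
  "transport r M N = (INF P \<in> couplings M N. \<integral>\<^sup>+(x, y). ennreal (r x y) \<partial>P)"


section \<open>The condition \<open>\<H>\<^sub>\<delta>(U,V)\<close>\<close>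

definition cost_V :: "'b measure \<Rightarrow> ('b \<Rightarrow> real) \<Rightarrow> ('a \<Rightarrow> 'b \<Rightarrow> real) \<Rightarrow> 'a \<Rightarrow> real" where
  "cost_V nu V W x = (\<integral>y. W x y \<partial>gibbs nu V)"

definition cost_U :: "'a measure \<Rightarrow> ('a \<Rightarrow> real) \<Rightarrow> ('a \<Rightarrow> 'b \<Rightarrow> real) \<Rightarrow> 'b \<Rightarrow> real" where
  "cost_U lam U W y = (\<integral>x. W x y \<partial>gibbs lam U)"

text \<open>Local boundedness of \<open>\<delta> U - W\<^sup>V\<close> and \<open>\<delta> V - W\<^sub>U\<close> tacitly contains that the
  integrated costs are well defined and finite.  Since a Bochner integral is 0 for a
  non-integrable function, this is stated separately.\<close>

definition condition_H ::
  "real \<Rightarrow> 'a::topological_space measure \<Rightarrow> 'b::topological_space measure \<Rightarrow>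
   ('a \<Rightarrow> real) \<Rightarrow> ('b \<Rightarrow> real) \<Rightarrow> ('a \<Rightarrow> 'b \<Rightarrow> real) \<Rightarrow> bool" where
  "condition_H \<delta> lam nu U V W \<longleftrightarrow>
     (\<forall>x. integrable (gibbs nu V) (\<lambda>y. W x y)) \<and>
     (\<forall>y. integrable (gibbs lam U) (\<lambda>x. W x y)) \<and>
     locally_bounded (\<lambda>x. \<delta> * U x - cost_V nu V W x) \<and>
     compact_sublevels (\<lambda>x. \<delta> * U x - cost_V nu V W x) \<and>
     locally_bounded (\<lambda>y. \<delta> * V y - cost_U lam U W y) \<and>
     compact_sublevels (\<lambda>y. \<delta> * V y - cost_U lam U W y) \<and>
     max (\<integral>\<^sup>+x. ennreal (exp (cost_V nu V W x)) \<partial>gibbs lam (\<lambda>x. (1 - \<delta>) * U x))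
         (\<integral>\<^sup>+y. ennreal (exp (cost_U lam U W y)) \<partial>gibbs nu (\<lambda>y. (1 - \<delta>) * V y)) < \<infinity>"


section \<open>Sinkhorn iterations\<close>

text \<open>The pair \<open>(U\<^sub>k, V\<^sub>k)\<close>: the step from an even index updates the second component, the step
  from an odd index the first one (see \<open>sinkhorn_U_even\<close>, \<open>sinkhorn_U_odd\<close>,
  \<open>sinkhorn_V_odd\<close> and \<open>sinkhorn_V_even\<close>).  The potentials are real-valued: at points where
  the integral under the logarithm diverges, the value is a conventional one.  In the setting
  of the theorem these points form a null set, which does not affect the distributions
  \<open>\<pi>\<^sub>n\<close>.\<close>

primrec sinkhorn_potentials ::
  "'a measure \<Rightarrow> 'b measure \<Rightarrow> ('a \<Rightarrow> real) \<Rightarrow> ('b \<Rightarrow> real) \<Rightarrow> ('a \<Rightarrow> 'b \<Rightarrow> real) \<Rightarrow> nat \<Rightarrow>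
   ('a \<Rightarrow> real) \<times> ('b \<Rightarrow> real)" where
  "sinkhorn_potentials lam nu U V W 0 = (U, \<lambda>y. 0)"
| "sinkhorn_potentials lam nu U V W (Suc k) =
    (let (u, v) = sinkhorn_potentials lam nu U V W k in
     if even k
     then (u, \<lambda>y. V y + ln (kernel_apply (kernel_R lam W) (\<lambda>x. exp (- u x)) y))
     else (\<lambda>x. U x + ln (kernel_apply (kernel_Q nu W) (\<lambda>y. exp (- v y)) x), v))"

definition sinkhorn_U where
  "sinkhorn_U lam nu U V W k = fst (sinkhorn_potentials lam nu U V W k)"

definition sinkhorn_V where
  "sinkhorn_V lam nu U V W k = snd (sinkhorn_potentials lam nu U V W k)"

definition sinkhorn_S_even where
  "sinkhorn_S_even lam nu U V W n x =
    (let f = (\<lambda>y. exp (- sinkhorn_V lam nu U V W (2 * n) y)) in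
     density (kernel_Q nu W x) (\<lambda>y. ennreal (f y / kernel_apply (kernel_Q nu W) f x)))"

definition sinkhorn_S_odd where
  "sinkhorn_S_odd lam nu U V W n y =
    (let f = (\<lambda>x. exp (- sinkhorn_U lam nu U V W (2 * n + 1) x)) in
     density (kernel_R lam W y) (\<lambda>x. ennreal (f x / kernel_apply (kernel_R lam W) f y)))"

text \<open>\<open>\<pi>\<^bsub>2n\<^esub>\<close>, on the second space, and \<open>\<pi>\<^bsub>2n+1\<^esub>\<close>, on the first space.\<close>

definition sinkhorn_pi_even where
  "sinkhorn_pi_even lam nu U V W n = gibbs lam U \<bind> sinkhorn_S_even lam nu U V W n"

definition sinkhorn_pi_odd where
  "sinkhorn_pi_odd lam nu U V W n = gibbs nu V \<bind> sinkhorn_S_odd lam nu U V W n"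

lemma sinkhorn_U_odd: "sinkhorn_U lam nu U V W (2 * n + 1) = sinkhorn_U lam nu U V W (2 * n)"
  by (simp add: sinkhorn_U_def Let_def split: prod.split)

lemma sinkhorn_V_even:
  "sinkhorn_V lam nu U V W (2 * (n + 1)) = sinkhorn_V lam nu U V W (2 * n + 1)"
  by (simp add: sinkhorn_V_def Let_def split: prod.split)

lemma sinkhorn_V_odd:
  "sinkhorn_V lam nu U V W (2 * n + 1) =
    (\<lambda>y. V y + ln (kernel_apply (kernel_R lam W) (\<lambda>x. exp (- sinkhorn_U lam nu U V W (2 * n) x)) y))"
  by (simp add: sinkhorn_V_def sinkhorn_U_def Let_def split: prod.split)

lemma sinkhorn_U_even:
  assumes "\<And>x. prob_space (kernel_Q nu W x)"
  shows "sinkhorn_U lam nu U V W (2 * n) =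
    (\<lambda>x. U x + ln (kernel_apply (kernel_Q nu W) (\<lambda>y. exp (- sinkhorn_V lam nu U V W (2 * n) y)) x))"
proof (cases n)
  case 0
  then show ?thesis
    using assms
    by (simp add: sinkhorn_U_def sinkhorn_V_def kernel_apply_def prob_space.prob_space)
next
  case (Suc m)
  then show ?thesis
    by (simp add: sinkhorn_U_def sinkhorn_V_def Let_def split: prod.split)
qed

lemma emeasure_tv_measure:
  assumes "finite_measure M" "finite_measure N" and s: "sets N = sets M" and A: "A \<in> sets M"
  shows "emeasure (tv_measure M N) A = tv_value M N A"
proof -
  interpret M: finite_measure M by fact
  interpret N: finite_measure N by fact
  obtain Y where Y: "Y \<in> sets M"
    and Y1: "\<And>X. X \<in> sets M \<Longrightarrow> X \<subseteq> Y \<Longrightarrow> emeasure N X \<le> emeasure M X"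
    and Y2: "\<And>X. X \<in> sets M \<Longrightarrow> X \<inter> Y = {} \<Longrightarrow> emeasure M X \<le> emeasure N X"
    using finite_unsigned_Hahn_decomposition[OF assms(1-3)] by auto
  define m where "m X = measure M X - measure N X" for X
  have m_pos: "m X \<ge> 0" if "X \<in> sets M" "X \<subseteq> Y" for X
    using Y1[OF that] by (simp add: m_def M.emeasure_eq_measure N.emeasure_eq_measure)
  have m_neg: "m X \<le> 0" if "X \<in> sets M" "X \<inter> Y = {}" for X
    using Y2[OF that] by (simp add: m_def M.emeasure_eq_measure N.emeasure_eq_measure)
  define h where "h X = m (X \<inter> Y) - m (X - Y)" for X
  have m_split: "m X = m (X \<inter> Y) + m (X - Y)" if "X \<in> sets M" for X
    using M.finite_measure_Union[of "X \<inter> Y" "X - Y"] N.finite_measure_Union[of "X \<inter> Y" "X - Y"]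
      that Y s by (simp add: m_def Int_Diff_disjoint Int_Diff_Un)
  have h_abs: "\<bar>m X\<bar> \<le> h X" if "X \<in> sets M" for X
    using m_split[OF that] m_pos[of "X \<inter> Y"] m_neg[of "X - Y"] that Y
    by (simp add: h_def Int_Diff_disjoint Int_commute)
  have h_nonneg: "h X \<ge> 0" if "X \<in> sets M" for X
    using h_abs[OF that] by linarith
  have m_sums: "(\<lambda>i. m (F i)) sums m (\<Union>i. F i)"
    if "range F \<subseteq> sets M" "disjoint_family F" for F :: "nat \<Rightarrow> _"
    unfolding m_def using that s
    by (intro sums_diff M.finite_measure_UNION N.finite_measure_UNION) auto
  have h_sums: "(\<lambda>i. h (F i)) sums h (\<Union>i. F i)"
    if F: "range F \<subseteq> sets M" "disjoint_family F" for F :: "nat \<Rightarrow> _"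
  proof -
    have "(\<lambda>i. m (F i \<inter> Y)) sums m (\<Union>i. F i \<inter> Y)"
      using F Y by (intro m_sums) (auto simp: disjoint_family_on_def)
    moreover have "(\<lambda>i. m (F i - Y)) sums m (\<Union>i. F i - Y)"
      using F Y by (intro m_sums) (auto simp: disjoint_family_on_def)
    moreover have "(\<Union>i. F i \<inter> Y) = (\<Union>i. F i) \<inter> Y" "(\<Union>i. F i - Y) = (\<Union>i. F i) - Y"
      by auto
    ultimately show ?thesis unfolding h_def by (simp only: sums_diff)
  qed
  have h_fin: "h (\<Union>P) = (\<Sum>E\<in>P. h E)" if "finite P" "P \<subseteq> sets M" "disjoint P" for P
    using that
  proof (induction P rule: finite_induct)
    case empty
    then show ?case by (simp add: h_def m_def)
  next
    case (insert E P)
    have d: "E \<inter> \<Union>P = {}"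
      using insert.prems(2) insert.hyps(2) by (auto simp: disjoint_def)
    have UP: "\<Union>P \<in> sets M" "E \<in> sets M" using insert by auto
    have add: "m (X \<union> X') = m X + m X'"
      if "X \<in> sets M" "X' \<in> sets M" "X \<inter> X' = {}" for X X'
      using M.finite_measure_Union[of X X'] N.finite_measure_Union[of X X'] that s
      by (simp add: m_def)
    have "m ((E \<union> \<Union>P) \<inter> Y) = m (E \<inter> Y) + m (\<Union>P \<inter> Y)"
      unfolding Int_Un_distrib2 using UP Y d by (intro add) auto
    moreover have "m ((E \<union> \<Union>P) - Y) = m (E - Y) + m (\<Union>P - Y)"
      unfolding Un_Diff using UP Y d by (intro add) auto
    ultimately have "h (E \<union> \<Union>P) = h E + h (\<Union>P)"
      by (simp add: h_def)
    moreover have "disjoint P" using insert.prems by (auto simp: disjoint_def)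
    ultimately show ?case using insert by simp
  qed
  have val: "tv_value M N X = ennreal (h X)" if X: "X \<in> sets M" for X
    unfolding tv_value_def
  proof (rule antisym)
    show "(SUP P \<in> {P. finite P \<and> P \<subseteq> sets M \<and> disjoint P \<and> \<Union>P = X}.
        \<Sum>E\<in>P. ennreal \<bar>measure M E - measure N E\<bar>) \<le> ennreal (h X)"
    proof (rule SUP_least)
      fix P assume P: "P \<in> {P. finite P \<and> P \<subseteq> sets M \<and> disjoint P \<and> \<Union>P = X}"
      have "(\<Sum>E\<in>P. ennreal \<bar>measure M E - measure N E\<bar>) = ennreal (\<Sum>E\<in>P. \<bar>m E\<bar>)"
        by (simp add: m_def sum_ennreal)
      also have "\<dots> \<le> ennreal (\<Sum>E\<in>P. h E)"
        using P by (intro ennreal_leI sum_mono h_abs) auto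
      also have "\<dots> = ennreal (h X)" using h_fin[of P] P by simp
      finally show "(\<Sum>E\<in>P. ennreal \<bar>measure M E - measure N E\<bar>) \<le> ennreal (h X)" .
    qed
    let ?P = "{X \<inter> Y, X - Y}"
    have "h X = (\<Sum>E\<in>?P. \<bar>m E\<bar>)"
    proof (cases "X \<inter> Y = X - Y")
      case True
      then have "X = {}" by auto
      then show ?thesis by (simp add: h_def m_def)
    next
      case False
      then show ?thesis using m_pos[of "X \<inter> Y"] m_neg[of "X - Y"] X Y
        by (simp add: h_def Int_commute)
    qed
    then have "ennreal (h X) = (\<Sum>E\<in>?P. ennreal \<bar>measure M E - measure N E\<bar>)"
      by (simp add: m_def sum_ennreal)
    also have "\<dots> \<le> (SUP P \<in> {P. finite P \<and> P \<subseteq> sets M \<and> disjoint P \<and> \<Union>P = X}.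
        \<Sum>E\<in>P. ennreal \<bar>measure M E - measure N E\<bar>)"
      using X Y by (intro SUP_upper) (auto simp: disjoint_def)
    finally show "ennreal (h X) \<le> \<dots>" .
  qed
  show ?thesis unfolding tv_measure_def
  proof (rule emeasure_measure_of_sigma)
    show "sigma_algebra (space M) (sets M)" ..
    show "positive (sets M) (tv_value M N)"
      by (simp add: positive_def val h_def m_def)
    show "countably_additive (sets M) (tv_value M N)"
    proof (rule countably_additiveI)
      fix F :: "nat \<Rightarrow> _"
      assume F: "range F \<subseteq> sets M" "disjoint_family F" "\<Union>(range F) \<in> sets M"
      have "(\<lambda>i. ennreal (h (F i))) sums ennreal (h (\<Union>i. F i))"
        using F h_sums[OF F(1,2)] h_nonneg
        by (subst sums_ennreal) auto
      then show "(\<Sum>i. tv_value M N (F i)) = tv_value M N (\<Union>(range F))"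
        using F by (auto simp: val range_subsetD sums_iff)
    qed
  qed fact
qed

end

theory Submission
  imports Defs
begin

text \<open>
  The errors of successive Sinkhorn marginals are images of one another under Markov kernels,
  and these kernels contract a weighted total variation norm at a rate that does not depend on
  the step.

  Write \<open>\<mu> = \<lambda>\<^sub>U\<close> and \<open>\<eta> = \<nu>\<^sub>V\<close>, and centre the potentials: \<open>u\<^sub>n = U\<^bsub>2n\<^esub> - U\<close> and
  \<open>v\<^sub>n = V\<^bsub>2n+1\<^esub> - V\<close>.  The recursion becomes symmetric in the two spaces,
  \<open>exp (v\<^sub>n y) = \<integral> exp (- W x y - u\<^sub>n x) \<mu>(dx)\<close> and
  \<open>exp (u\<^bsub>n+1\<^esub> x) = \<integral> exp (- W x y - v\<^sub>n y) \<eta>(dy)\<close> with \<open>u\<^sub>0 = 0\<close>, and \<open>\<pi>\<^bsub>2n+2\<^esub>\<close> has the density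
  \<open>exp (v\<^bsub>n+1\<^esub> - v\<^sub>n)\<close> with respect to \<open>\<eta>\<close>, while \<open>\<pi>\<^bsub>2n+1\<^esub>\<close> has the density
  \<open>exp (u\<^bsub>n+1\<^esub> - u\<^sub>n)\<close> with respect to \<open>\<mu>\<close>.  The Markov kernel with density
  \<open>exp (- W x y - u\<^bsub>n+1\<^esub> x - v\<^sub>n y)\<close> turns \<open>exp (u\<^bsub>n+1\<^esub> - u\<^sub>n) - 1\<close> into the negative of
  \<open>exp (v\<^bsub>n+1\<^esub> - v\<^sub>n) - 1\<close> (lemma \<open>kernel_maps_deviation\<close>), and the same holds with the two
  spaces exchanged.

  The rate is uniform because the potentials are.  Jensen's inequality gives
  \<open>v\<^sub>n \<ge> - W\<^sub>U - \<integral> u\<^sub>n d\<mu>\<close>.  Conservation of mass, \<open>\<integral> exp (u\<^bsub>n+1\<^esub> - u\<^sub>n) d\<mu> = 1\<close>, makes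
  \<open>\<integral> u\<^sub>n d\<mu>\<close> decrease (lemma \<open>round_trip_decreases_integral\<close>).  So \<open>u\<^sub>n + W\<^sup>V\<close> and
  \<open>v\<^sub>n + W\<^sub>U\<close> are bounded below independently of \<open>n\<close>.  Put back into the recursion, these
  bounds together with the boundedness of \<open>exp (- W)\<close> and the integrability of \<open>exp W\<^sup>V\<close> and
  \<open>exp W\<^sub>U\<close> bound \<open>u\<^sub>n\<close> and \<open>v\<^sub>n\<close> above by constants (lemma \<open>tame_potentials\<close>).

  For potentials with such bounds the kernel is dominated by a multiple of
  \<open>exp (W\<^sup>V x) exp (W\<^sub>U y) \<eta>(dy)\<close>.  As \<open>\<delta> U - W\<^sup>V\<close> has compact sublevel sets, \<open>exp W\<^sup>V\<close> is of
  smaller order than \<open>\<phi>\<close>; this is a Lyapunov condition with arbitrarily small slope (lemma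
  \<open>tame_lyapunov\<close>).  On sublevel sets of \<open>\<phi>\<close> and \<open>\<psi>\<close> the cost \<open>W\<close> is bounded, which gives a
  minorization (lemma \<open>tame_minorization\<close>).  The two together imply contraction by a
  Harris-type argument (lemma \<open>centred_kernel_contraction\<close>).

  Finally, two probability measures with densities \<open>p\<close> and \<open>q\<close> have a coupling that keeps their
  common part on the diagonal, so that a cost dominated by \<open>w x + w y\<close> is transported at a price
  of at most the integral of \<open>w\<close> against \<open>\<bar>p - q\<bar>\<close> (lemma \<open>transport_density_le\<close>).
\<close>

section \<open>Total variation, couplings and kernels with densities\<close>

text \<open>Splitting a set along \<open>{q \<le> p}\<close> gives a partition on which the supremum that defines the
  total variation measure is attained.\<close>

lemma nn_integral_abs_diff_le_tv_norm_diff: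
  assumes p[measurable]: "p \<in> borel_measurable N" and q[measurable]: "q \<in> borel_measurable N"
    and p0: "\<And>x. 0 \<le> p x" and q0: "\<And>x. 0 \<le> q x"
    and P: "prob_space (density N (\<lambda>x. ennreal (p x)))"
    and Q: "prob_space (density N (\<lambda>x. ennreal (q x)))"
    and \<theta>[measurable]: "\<theta> \<in> borel_measurable N"
  shows "(\<integral>\<^sup>+x. ennreal (\<theta> x) * ennreal \<bar>p x - q x\<bar> \<partial>N)
    \<le> tv_norm_diff \<theta> (density N (\<lambda>x. ennreal (p x))) (density N (\<lambda>x. ennreal (q x)))"
proof -
  let ?P = "density N (\<lambda>x. ennreal (p x))" and ?Q = "density N (\<lambda>x. ennreal (q x))"
  let ?D = "density N (\<lambda>x. ennreal \<bar>p x - q x\<bar>)"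
  interpret P: prob_space ?P by fact
  interpret Q: prob_space ?Q by fact
  have dens_diff: "emeasure (density N (\<lambda>x. ennreal (f x - g x))) A
      = ennreal \<bar>measure (density N (\<lambda>x. ennreal (f x))) A - measure (density N (\<lambda>x. ennreal (g x))) A\<bar>"
    if A[measurable]: "A \<in> sets N" and le: "\<And>x. x \<in> A \<Longrightarrow> g x \<le> f x"
      and [measurable]: "f \<in> borel_measurable N" "g \<in> borel_measurable N"
      and g0: "\<And>x. 0 \<le> g x" and fm: "prob_space (density N (\<lambda>x. ennreal (f x)))"
      and gm: "prob_space (density N (\<lambda>x. ennreal (g x)))" for f g :: "'a \<Rightarrow> real" and A
  proof -
    interpret f: prob_space "density N (\<lambda>x. ennreal (f x))" by fact
    interpret g: prob_space "density N (\<lambda>x. ennreal (g x))" by fact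
    let ?d = "emeasure (density N (\<lambda>x. ennreal (f x - g x))) A"
    have *: "?d + emeasure (density N (\<lambda>x. ennreal (g x))) A = emeasure (density N (\<lambda>x. ennreal (f x))) A"
      using le g0
      by (simp add: emeasure_density nn_integral_add[symmetric])
        (auto intro!: nn_integral_cong simp: indicator_def ennreal_plus[symmetric] simp del: ennreal_plus)
    then have "?d + ennreal (measure (density N (\<lambda>x. ennreal (g x))) A)
        = ennreal (measure (density N (\<lambda>x. ennreal (f x))) A)"
      by (simp add: f.emeasure_eq_measure g.emeasure_eq_measure)
    then have "?d = ennreal (measure (density N (\<lambda>x. ennreal (f x))) A)
        - ennreal (measure (density N (\<lambda>x. ennreal (g x))) A)"
      by (metis ennreal_add_diff_cancel_right ennreal_neq_top)
    moreover have "measure (density N (\<lambda>x. ennreal (g x))) A \<le> measure (density N (\<lambda>x. ennreal (f x))) A"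
      using * by (metis f.emeasure_eq_measure g.emeasure_eq_measure add.commute ennreal_le_iff le_iff_add measure_nonneg)
    ultimately show ?thesis by (simp add: ennreal_minus)
  qed
  have le: "emeasure ?D A \<le> emeasure (tv_measure ?P ?Q) A" if A[measurable]: "A \<in> sets N" for A
  proof -
    let ?S = "{x \<in> space N. q x \<le> p x}"
    have [measurable]: "?S \<in> sets N" by measurable
    let ?E = "{A \<inter> ?S, A - ?S}"
    have "emeasure ?D A = emeasure ?D (A \<inter> ?S) + emeasure ?D (A - ?S)"
      by (subst plus_emeasure) (auto simp: Int_Diff_Un)
    also have "emeasure ?D (A \<inter> ?S) = emeasure (density N (\<lambda>x. ennreal (p x - q x))) (A \<inter> ?S)"
      by (auto simp: emeasure_density indicator_def intro!: nn_integral_cong)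
    also have "\<dots> = ennreal \<bar>measure ?P (A \<inter> ?S) - measure ?Q (A \<inter> ?S)\<bar>"
      by (rule dens_diff) (use q0 P Q in auto)
    also have "emeasure ?D (A - ?S) = emeasure (density N (\<lambda>x. ennreal (q x - p x))) (A - ?S)"
      using sets.sets_into_space[OF A]
      by (auto simp: emeasure_density indicator_def intro!: nn_integral_cong)
    also have "\<dots> = ennreal \<bar>measure ?Q (A - ?S) - measure ?P (A - ?S)\<bar>"
      by (rule dens_diff) (use p0 P Q sets.sets_into_space[OF A] in auto)
    also have "\<dots> = ennreal \<bar>measure ?P (A - ?S) - measure ?Q (A - ?S)\<bar>"
      by (simp add: abs_minus_commute)
    also have "ennreal \<bar>measure ?P (A \<inter> ?S) - measure ?Q (A \<inter> ?S)\<bar>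
          + ennreal \<bar>measure ?P (A - ?S) - measure ?Q (A - ?S)\<bar>
        = (\<Sum>E\<in>?E. ennreal \<bar>measure ?P E - measure ?Q E\<bar>)"
    proof (cases "A \<inter> ?S = A - ?S")
      case True
      then have E: "A \<inter> ?S = {}" "A - ?S = {}" by auto
      show ?thesis unfolding E by simp
    qed simp
    also have "\<dots> \<le> tv_value ?P ?Q A"
      unfolding tv_value_def by (intro SUP_upper) (auto simp: disjoint_def)
    also have "\<dots> = emeasure (tv_measure ?P ?Q) A"
      by (rule emeasure_tv_measure[symmetric]) (auto intro: P.finite_measure_axioms Q.finite_measure_axioms)
    finally show ?thesis .
  qed
  have s: "sets (tv_measure ?P ?Q) = sets N"
    using sets.space_closed[of ?P]
    by (simp add: tv_measure_def sets_measure_of sets.sigma_sets_eq sets.space_closed)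
  have "(\<integral>\<^sup>+x. ennreal (\<theta> x) * ennreal \<bar>p x - q x\<bar> \<partial>N) = (\<integral>\<^sup>+x. ennreal (\<theta> x) \<partial>?D)"
    by (subst nn_integral_density) (auto simp: mult.commute)
  also have "\<dots> \<le> (\<integral>\<^sup>+x. ennreal (\<theta> x) \<partial>tv_measure ?P ?Q)"
    using le s by (intro nn_integral_mono_measure) (auto simp: le_measure)
  finally show ?thesis by (simp add: tv_norm_diff_def)
qed

text \<open>The classical coupling that leaves as much mass as possible on the diagonal: the common part
  \<open>min p q\<close> sits on the diagonal, and the excess of \<open>p\<close> over \<open>q\<close> is coupled independently
  with the excess of \<open>q\<close> over \<open>p\<close>.  A Boolean coordinate selects the part, so that the sum of
  two measures becomes the image of a single density.  When \<open>p\<close> and \<open>q\<close> agree almost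
  everywhere, the division by zero yields \<open>0\<close> and the second part vanishes.\<close>

definition mixed_coupling :: "'a measure \<Rightarrow> ('a \<Rightarrow> real) \<Rightarrow> ('a \<Rightarrow> real) \<Rightarrow> ('a \<times> 'a) measure" where
  "mixed_coupling N p q =
    distr
      (density (count_space UNIV \<Otimes>\<^sub>M (N \<Otimes>\<^sub>M N))
        (\<lambda>(s, x, y). ennreal (if s then min (p x) (q x)
           else max 0 (p x - q x) * max 0 (q y - p y) / (\<integral>z. max 0 (p z - q z) \<partial>N))))
      (N \<Otimes>\<^sub>M N) (\<lambda>(s, x, y). if s then (x, x) else (x, y))"

lemma nn_integral_mixed_coupling:
  assumes N: "prob_space N"
    and p[measurable]: "p \<in> borel_measurable N" and q[measurable]: "q \<in> borel_measurable N"
    and F[measurable]: "F \<in> borel_measurable (N \<Otimes>\<^sub>M N)"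
  shows "(\<integral>\<^sup>+z. F z \<partial>mixed_coupling N p q) =
    (\<integral>\<^sup>+x. ennreal (min (p x) (q x)) * F (x, x) \<partial>N) +
    (\<integral>\<^sup>+x. (\<integral>\<^sup>+y. ennreal (max 0 (p x - q x) * max 0 (q y - p y) / (\<integral>z. max 0 (p z - q z) \<partial>N))
        * F (x, y) \<partial>N) \<partial>N)"
proof -
  interpret N: prob_space N by fact
  interpret NN: pair_prob_space N N ..
  define h where "h = (\<lambda>(s, x, y). ennreal (if s then min (p x) (q x)
           else max 0 (p x - q x) * max 0 (q y - p y) / (\<integral>z. max 0 (p z - q z) \<partial>N)))"
  define t :: "bool \<times> 'a \<times> 'a \<Rightarrow> 'a \<times> 'a" where "t = (\<lambda>(s, x, y). if s then (x, x) else (x, y))"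
  have h[measurable]: "h \<in> borel_measurable (count_space UNIV \<Otimes>\<^sub>M (N \<Otimes>\<^sub>M N))"
    unfolding h_def by measurable
  have t[measurable]: "t \<in> (count_space UNIV \<Otimes>\<^sub>M (N \<Otimes>\<^sub>M N)) \<rightarrow>\<^sub>M N \<Otimes>\<^sub>M N"
    unfolding t_def by measurable
  have s: "pair_sigma_finite (count_space (UNIV :: bool set)) (N \<Otimes>\<^sub>M N)"
    by (simp add: pair_sigma_finite_def sigma_finite_measure_count_space_finite NN.sigma_finite_measure_axioms)
  have "(\<integral>\<^sup>+z. F z \<partial>mixed_coupling N p q)
      = (\<integral>\<^sup>+z. F z \<partial>distr (density (count_space UNIV \<Otimes>\<^sub>M (N \<Otimes>\<^sub>M N)) h) (N \<Otimes>\<^sub>M N) t)"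
    by (simp add: mixed_coupling_def h_def t_def)
  also have "\<dots> = (\<integral>\<^sup>+z. h z * F (t z) \<partial>(count_space UNIV \<Otimes>\<^sub>M (N \<Otimes>\<^sub>M N)))"
    by (simp add: nn_integral_distr nn_integral_density)
  also have "\<dots> = (\<integral>\<^sup>+s. \<integral>\<^sup>+z. h (s, z) * F (t (s, z)) \<partial>(N \<Otimes>\<^sub>M N) \<partial>count_space UNIV)"
    by (rule NN.nn_integral_fst[symmetric]) measurable
  also have "\<dots> = (\<integral>\<^sup>+z. h (True, z) * F (t (True, z)) \<partial>(N \<Otimes>\<^sub>M N))
      + (\<integral>\<^sup>+z. h (False, z) * F (t (False, z)) \<partial>(N \<Otimes>\<^sub>M N))"
    by (simp add: nn_integral_count_space_finite UNIV_bool add.commute)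
  also have "\<dots> = (\<integral>\<^sup>+x. \<integral>\<^sup>+y. h (True, x, y) * F (t (True, x, y)) \<partial>N \<partial>N)
      + (\<integral>\<^sup>+x. \<integral>\<^sup>+y. h (False, x, y) * F (t (False, x, y)) \<partial>N \<partial>N)"
    by (intro arg_cong2[where f="(+)"]; rule N.nn_integral_fst[symmetric]; measurable)
  finally show ?thesis
    by (simp add: h_def t_def N.emeasure_space_1)
qed

text \<open>The diagonal part of the mixed coupling is moved for free, and on the independent part
  \<open>w x + w y\<close> integrates to the sum of the two one-sided excesses.\<close>

lemma transport_density_le:
  assumes N: "prob_space N"
    and p[measurable]: "p \<in> borel_measurable N" and q[measurable]: "q \<in> borel_measurable N"
    and p0: "\<And>x. 0 \<le> p x" and q0: "\<And>x. 0 \<le> q x"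
    and P: "prob_space (density N (\<lambda>x. ennreal (p x)))"
    and Q: "prob_space (density N (\<lambda>x. ennreal (q x)))"
    and w[measurable]: "w \<in> borel_measurable N" and w0: "\<And>x. 0 \<le> w x"
    and r[measurable]: "case_prod r \<in> borel_measurable (N \<Otimes>\<^sub>M N)"
    and r_diag: "\<And>x. r x x = 0" and r_le: "\<And>x y. r x y \<le> w x + w y"
  shows "transport r (density N (\<lambda>x. ennreal (p x))) (density N (\<lambda>x. ennreal (q x)))
    \<le> (\<integral>\<^sup>+x. ennreal (w x) * ennreal \<bar>p x - q x\<bar> \<partial>N)"
proof -
  let ?P = "density N (\<lambda>x. ennreal (p x))" and ?Q = "density N (\<lambda>x. ennreal (q x))"
  interpret N: prob_space N by fact
  interpret NN: pair_prob_space N N ..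
  let ?C = "mixed_coupling N p q"
  define d e where "d x = max 0 (p x - q x)" and "e x = max 0 (q x - p x)" for x
  define m where "m = (\<integral>x. d x \<partial>N)"
  have [measurable]: "d \<in> borel_measurable N" "e \<in> borel_measurable N"
    by (simp_all add: d_def[abs_def] e_def[abs_def])
  have d0: "0 \<le> d x" "0 \<le> e x" for x by (auto simp: d_def e_def)
  have ip: "(\<integral>\<^sup>+x. ennreal (p x) \<partial>N) = 1" and iq: "(\<integral>\<^sup>+x. ennreal (q x) \<partial>N) = 1"
    using prob_space.emeasure_space_1[OF P] prob_space.emeasure_space_1[OF Q]
    by (simp_all add: emeasure_density cong: nn_integral_cong)
  have int[simp]: "integrable N p" "integrable N q"
    using p0 q0 ip iq by (auto intro!: integrableI_nonneg)
  have "(\<integral>x. p x \<partial>N) = 1" "(\<integral>x. q x \<partial>N) = 1"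
    using p0 q0 ip iq by (auto simp: integral_eq_nn_integral)
  then have "(\<integral>x. d x - e x \<partial>N) = 0"
    by (simp add: d_def e_def max_def if_distrib cong: if_cong
        flip: Bochner_Integration.integral_diff) (simp add: algebra_simps)
  moreover have di[simp]: "integrable N d" "integrable N e"
    by (simp_all add: d_def[abs_def] e_def[abs_def])
  ultimately have em: "(\<integral>x. e x \<partial>N) = m" by (simp add: m_def)
  have m0: "0 \<le> m" using d0 by (simp add: m_def)
  have nd: "(\<integral>\<^sup>+x. ennreal (d x) \<partial>N) = ennreal m" and ne: "(\<integral>\<^sup>+x. ennreal (e x) \<partial>N) = ennreal m"
    using d0 em by (simp_all add: nn_integral_eq_integral m_def)
  have I: "(\<integral>\<^sup>+z. F z \<partial>?C) = (\<integral>\<^sup>+x. ennreal (min (p x) (q x)) * F (x, x) \<partial>N) +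
      (\<integral>\<^sup>+x. (\<integral>\<^sup>+y. ennreal (d x * e y / m) * F (x, y) \<partial>N) \<partial>N)"
    if "F \<in> borel_measurable (N \<Otimes>\<^sub>M N)" for F
    using nn_integral_mixed_coupling[OF N p q that] by (simp add: d_def e_def m_def)
  have zd: "AE x in N. d x = 0" and ze: "AE x in N. e x = 0" if "m = 0"
    using nd ne d0 that by (auto simp: nn_integral_0_iff_AE)
  \<comment> \<open>The excesses have the same mass \<open>m\<close>, so the independent part has the excesses as marginals, also for \<open>m = 0\<close>.\<close>
  have fst_part: "(\<integral>\<^sup>+x. (\<integral>\<^sup>+y. ennreal (d x * e y / m) * f x \<partial>N) \<partial>N) = (\<integral>\<^sup>+x. ennreal (d x) * f x \<partial>N)"
    if [measurable]: "f \<in> borel_measurable N" for f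
  proof (cases "m = 0")
    case True
    have "(\<integral>\<^sup>+x. ennreal (d x) * f x \<partial>N) = (\<integral>\<^sup>+x. 0 \<partial>N)"
      using zd[OF True] by (intro nn_integral_cong_AE) auto
    then show ?thesis using True by simp
  next
    case False
    have "(\<integral>\<^sup>+y. ennreal (d x * e y / m) * f x \<partial>N) = ennreal (d x) * f x" for x
    proof -
      have "(\<integral>\<^sup>+y. ennreal (d x * e y / m) * f x \<partial>N) = (\<integral>\<^sup>+y. (ennreal (d x / m) * f x) * ennreal (e y) \<partial>N)"
        using d0 m0 by (intro nn_integral_cong) (simp add: ennreal_mult[symmetric] mult.assoc mult.commute mult.left_commute)
      also have "\<dots> = ennreal (d x / m) * f x * ennreal m"
        by (simp add: nn_integral_cmult ne)
      also have "\<dots> = ennreal (d x / m * m) * f x"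
        unfolding ennreal_mult''[OF m0] by (simp only: mult_ac)
      finally show ?thesis using False by simp
    qed
    then show ?thesis by simp
  qed
  have snd_part: "(\<integral>\<^sup>+x. (\<integral>\<^sup>+y. ennreal (d x * e y / m) * f y \<partial>N) \<partial>N) = (\<integral>\<^sup>+y. ennreal (e y) * f y \<partial>N)"
    if [measurable]: "f \<in> borel_measurable N" for f
  proof (cases "m = 0")
    case True
    have "(\<integral>\<^sup>+x. ennreal (e x) * f x \<partial>N) = (\<integral>\<^sup>+x. 0 \<partial>N)"
      using ze[OF True] by (intro nn_integral_cong_AE) auto
    then show ?thesis using True by simp
  next
    case False
    have "(\<integral>\<^sup>+x. (\<integral>\<^sup>+y. ennreal (d x * e y / m) * f y \<partial>N) \<partial>N)
        = (\<integral>\<^sup>+x. ennreal (d x) * (ennreal (1 / m) * (\<integral>\<^sup>+y. ennreal (e y) * f y \<partial>N)) \<partial>N)"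
    proof (rule nn_integral_cong)
      fix x
      have "(\<integral>\<^sup>+y. ennreal (d x * e y / m) * f y \<partial>N)
          = (\<integral>\<^sup>+y. (ennreal (d x) * ennreal (1 / m)) * (ennreal (e y) * f y) \<partial>N)"
        using d0 m0 by (intro nn_integral_cong) (simp add: ennreal_mult[symmetric] mult.assoc[symmetric])
      then show "(\<integral>\<^sup>+y. ennreal (d x * e y / m) * f y \<partial>N)
          = ennreal (d x) * (ennreal (1 / m) * (\<integral>\<^sup>+y. ennreal (e y) * f y \<partial>N))"
        by (simp add: nn_integral_cmult mult.assoc)
    qed
    also have "\<dots> = ennreal m * ennreal (1 / m) * (\<integral>\<^sup>+y. ennreal (e y) * f y \<partial>N)"
      by (simp add: nn_integral_multc nd mult.assoc)
    also have "ennreal m * ennreal (1 / m) = 1"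
      using m0 False by (simp add: ennreal_mult[symmetric])
    finally show ?thesis by simp
  qed
  have min_d: "ennreal (min (p x) (q x)) + ennreal (d x) = ennreal (p x)" for x
    using p0 q0 by (auto simp: d_def ennreal_plus[symmetric] min_def max_def simp del: ennreal_plus)
  have min_e: "ennreal (min (p x) (q x)) + ennreal (e x) = ennreal (q x)" for x
    using p0 q0 by (auto simp: e_def ennreal_plus[symmetric] min_def max_def simp del: ennreal_plus)
  have marg1: "(\<integral>\<^sup>+z. f (fst z) \<partial>?C) = (\<integral>\<^sup>+x. ennreal (p x) * f x \<partial>N)"
    if [measurable]: "f \<in> borel_measurable N" for f
    by (simp add: I fst_part nn_integral_add[symmetric] distrib_right[symmetric] min_d)
  have marg2: "(\<integral>\<^sup>+z. f (snd z) \<partial>?C) = (\<integral>\<^sup>+x. ennreal (q x) * f x \<partial>N)"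
    if [measurable]: "f \<in> borel_measurable N" for f
    by (simp add: I snd_part nn_integral_add[symmetric] distrib_right[symmetric] min_e)
  have sC[measurable_cong, simp]: "sets ?C = sets (N \<Otimes>\<^sub>M N)" by (simp add: mixed_coupling_def)
  have spC: "space ?C = space N \<times> space N"
    by (simp add: mixed_coupling_def space_pair_measure)
  have "emeasure ?C (space ?C) = 1"
    using marg1[of "\<lambda>_. 1"] ip by simp
  then have C: "prob_space ?C" by (rule prob_spaceI)
  have "distr ?C ?P fst = ?P"
  proof (rule measure_eqI)
    fix A assume "A \<in> sets (distr ?C ?P fst)"
    then have A[measurable]: "A \<in> sets N" by simp
    have "emeasure (distr ?C ?P fst) A = (\<integral>\<^sup>+z. indicator A (fst z) \<partial>?C)"
      by (subst nn_integral_indicator[symmetric], simp, subst nn_integral_distr)  auto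
    then show "emeasure (distr ?C ?P fst) A = emeasure ?P A"
      by (simp add: marg1 emeasure_density)
  qed simp
  moreover have "distr ?C ?Q snd = ?Q"
  proof (rule measure_eqI)
    fix A assume "A \<in> sets (distr ?C ?Q snd)"
    then have A[measurable]: "A \<in> sets N" by simp
    have "emeasure (distr ?C ?Q snd) A = (\<integral>\<^sup>+z. indicator A (snd z) \<partial>?C)"
      by (subst nn_integral_indicator[symmetric], simp, subst nn_integral_distr) auto
    then show "emeasure (distr ?C ?Q snd) A = emeasure ?Q A"
      by (simp add: marg2 emeasure_density)
  qed simp
  ultimately have mem: "?C \<in> couplings ?P ?Q"
    using C by (simp add: couplings_def space_prob_algebra cong: sets_pair_measure_cong)
  have "transport r ?P ?Q \<le> (\<integral>\<^sup>+z. ennreal (case_prod r z) \<partial>?C)"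
    unfolding transport_def by (rule INF_lower2[OF mem]) (simp add: case_prod_beta')
  also have "\<dots> = (\<integral>\<^sup>+x. (\<integral>\<^sup>+y. ennreal (d x * e y / m) * ennreal (r x y) \<partial>N) \<partial>N)"
    by (simp add: I r_diag)
  also have "\<dots> \<le> (\<integral>\<^sup>+x. (\<integral>\<^sup>+y. ennreal (d x * e y / m) * (ennreal (w x) + ennreal (w y)) \<partial>N) \<partial>N)"
    using r_le w0 by (intro nn_integral_mono mult_left_mono) (auto simp flip: ennreal_plus)
  also have "\<dots> = (\<integral>\<^sup>+x. (\<integral>\<^sup>+y. ennreal (d x * e y / m) * ennreal (w x) \<partial>N) \<partial>N)
      + (\<integral>\<^sup>+x. (\<integral>\<^sup>+y. ennreal (d x * e y / m) * ennreal (w y) \<partial>N) \<partial>N)"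
    by (simp add: distrib_left nn_integral_add)
  also have "\<dots> = (\<integral>\<^sup>+x. ennreal (w x) * ennreal \<bar>p x - q x\<bar> \<partial>N)"
  proof -
    have "ennreal (d x) * ennreal (w x) + ennreal (e x) * ennreal (w x) = ennreal (w x) * ennreal \<bar>p x - q x\<bar>" for x
      unfolding distrib_right[symmetric] by (simp add: d_def e_def mult.commute max_def abs_if)
    then show ?thesis by (simp add: fst_part snd_part nn_integral_add[symmetric])
  qed
  finally show ?thesis .
qed

lemma bind_density_eq_density:
  fixes k :: "'a \<Rightarrow> 'b \<Rightarrow> ennreal"
  assumes M: "prob_space M" and N: "sigma_finite_measure N"
    and k[measurable]: "case_prod k \<in> borel_measurable (M \<Otimes>\<^sub>M N)"
    and sub: "\<And>x. x \<in> space M \<Longrightarrow> subprob_space (density N (k x))"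
  shows "M \<bind> (\<lambda>x. density N (k x)) = density N (\<lambda>y. \<integral>\<^sup>+x. k x y \<partial>M)"
proof -
  interpret M: prob_space M by fact
  interpret N: sigma_finite_measure N by fact
  interpret MN: pair_sigma_finite M N ..
  have kern: "(\<lambda>x. density N (k x)) \<in> M \<rightarrow>\<^sub>M subprob_algebra N"
  proof (rule measurable_subprob_algebra)
    fix A assume A[measurable]: "A \<in> sets N"
    have "(\<lambda>x. \<integral>\<^sup>+y. k x y * indicator A y \<partial>N) \<in> borel_measurable M" by measurable
    then show "(\<lambda>x. emeasure (density N (k x)) A) \<in> borel_measurable M"
      by (rule measurable_cong[THEN iffD1, rotated]) (simp add: emeasure_density)
  qed (use sub in auto)
  show ?thesis
  proof (rule measure_eqI)
    show s: "sets (M \<bind> (\<lambda>x. density N (k x))) = sets (density N (\<lambda>y. \<integral>\<^sup>+x. k x y \<partial>M))"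
      using sets_bind[of M "\<lambda>x. density N (k x)" N] M.not_empty by simp
    fix A assume "A \<in> sets (M \<bind> (\<lambda>x. density N (k x)))"
    then have A[measurable]: "A \<in> sets N" using s by simp
    have "emeasure (M \<bind> (\<lambda>x. density N (k x))) A = (\<integral>\<^sup>+x. \<integral>\<^sup>+y. k x y * indicator A y \<partial>N \<partial>M)"
      by (subst emeasure_bind[OF M.not_empty kern A]) (auto simp: emeasure_density intro!: nn_integral_cong)
    also have "\<dots> = (\<integral>\<^sup>+y. \<integral>\<^sup>+x. k x y * indicator A y \<partial>M \<partial>N)"
      by (rule MN.Fubini'[symmetric]) simp
    also have "\<dots> = (\<integral>\<^sup>+y. (\<integral>\<^sup>+x. k x y \<partial>M) * indicator A y \<partial>N)"
      by (auto intro!: nn_integral_cong nn_integral_multc)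
    finally show "emeasure (M \<bind> (\<lambda>x. density N (k x))) A = emeasure (density N (\<lambda>y. \<integral>\<^sup>+x. k x y \<partial>M)) A"
      by (simp add: emeasure_density)
  qed
qed

text \<open>The weighted \<open>L\<^sup>1\<close> distance of the densities bounds the transport cost from above and the
  total variation norm from below, so its decay passes to the two of them.\<close>

lemma transport_le_tv_norm_diff_if_decay:
  assumes N: "prob_space N"
    and p[measurable]: "p \<in> borel_measurable N" and p0: "\<And>x. 0 \<le> p x"
    and P: "prob_space (density N (\<lambda>x. ennreal (p x)))"
    and q[measurable]: "q \<in> borel_measurable N" and q0: "\<And>x. 0 \<le> q x"
    and Q: "prob_space (density N (\<lambda>x. ennreal (q x)))"
    and \<psi>[measurable]: "\<psi> \<in> borel_measurable N" and \<psi>0: "\<And>x. 0 \<le> \<psi> x"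
    and r: "case_prod r \<in> borel_measurable (N \<Otimes>\<^sub>M N)" "\<And>x. r x x = 0"
    and A: "0 \<le> A" and r_le: "\<And>x y. r x y \<le> A * \<psi> x + A * \<psi> y" and "0 \<le> \<kappa>"
    and decay: "(\<integral>\<^sup>+x. ennreal (\<psi> x) * ennreal \<bar>p x - 1\<bar> \<partial>N)
      \<le> ennreal \<kappa> * (\<integral>\<^sup>+x. ennreal (\<psi> x) * ennreal \<bar>q x - 1\<bar> \<partial>N)"
  shows "transport r (density N (\<lambda>x. ennreal (p x))) N
    \<le> ennreal (A * \<kappa>) * tv_norm_diff \<psi> (density N (\<lambda>x. ennreal (q x))) N"
proof -
  have N1: "density N (\<lambda>x. ennreal 1) = N" by (simp add: density_1)
  have "transport r (density N (\<lambda>x. ennreal (p x))) (density N (\<lambda>x. ennreal 1))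
      \<le> (\<integral>\<^sup>+x. ennreal (A * \<psi> x) * ennreal \<bar>p x - 1\<bar> \<partial>N)"
    by (rule transport_density_le) (use N N1 P p0 r r_le A \<psi>0 in auto)
  also have "\<dots> = (\<integral>\<^sup>+x. ennreal A * (ennreal (\<psi> x) * ennreal \<bar>p x - 1\<bar>) \<partial>N)"
    using A \<psi>0 by (simp add: ennreal_mult mult.assoc)
  also have "\<dots> = ennreal A * (\<integral>\<^sup>+x. ennreal (\<psi> x) * ennreal \<bar>p x - 1\<bar> \<partial>N)"
    by (rule nn_integral_cmult) measurable
  also have "\<dots> \<le> ennreal A * (ennreal \<kappa> * (\<integral>\<^sup>+x. ennreal (\<psi> x) * ennreal \<bar>q x - 1\<bar> \<partial>N))"
    using decay by (rule mult_left_mono) simp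
  also have "\<dots> \<le> ennreal A * (ennreal \<kappa> *
      tv_norm_diff \<psi> (density N (\<lambda>x. ennreal (q x))) (density N (\<lambda>x. ennreal 1)))"
    by (intro mult_left_mono nn_integral_abs_diff_le_tv_norm_diff) (use N N1 q0 Q in auto)
  also have "\<dots> = ennreal (A * \<kappa>) * tv_norm_diff \<psi> (density N (\<lambda>x. ennreal (q x))) (density N (\<lambda>x. ennreal 1))"
    using A \<open>0 \<le> \<kappa>\<close> by (simp add: ennreal_mult mult.assoc)
  finally show ?thesis by (simp only: N1)
qed

section \<open>Contraction of centred densities under a Lyapunov condition and a minorization\<close>

lemma ennreal_le_diff:
  assumes "z + ennreal a \<le> ennreal b" and "0 \<le> a"
  shows "z \<le> ennreal (b - a)"
proof -
  have "z = z + ennreal a - ennreal a" by (simp add: ennreal_add_diff_cancel_right)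
  also have "\<dots> \<le> ennreal b - ennreal a" using assms(1) by (rule ennreal_minus_mono) simp
  finally show ?thesis using assms(2) by (simp add: ennreal_minus)
qed

text \<open>A contraction in the norm with weight \<open>1 + \<beta> \<phi>\<close>, in the spirit of Harris' theorem.  As \<open>f\<close> is
  centred, subtracting from the kernel the constant kernel \<open>\<alpha> g\<close> does not change the image of
  \<open>f\<close>, and it remains to bound \<open>\<integral> \<bar>k x y - \<alpha> g y\<bar> (1 + \<beta> \<psi> y) dy\<close> for each \<open>x\<close>.
  If \<open>\<phi> x \<le> R\<close>, the minorization makes the difference nonnegative and the mass drops by
  \<open>\<alpha>\<close>, while the Lyapunov constant costs only \<open>\<beta> c = \<alpha> / 2\<close>.  If \<open>\<phi> x > R\<close>, the mass may grow
  by \<open>\<alpha>\<close>, but then \<open>\<beta> \<phi> x\<close> is large compared with \<open>\<alpha>\<close>.  With \<open>\<beta>\<close> proportional to \<open>\<alpha>\<close> the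
  threshold \<open>R\<close> depends on \<open>c\<close> and \<open>r\<close> alone; so \<open>R\<close> can be fixed before the minorization
  constant \<open>\<alpha>\<close>, which usually decreases in \<open>R\<close>.\<close>

lemma centred_kernel_contraction:
  fixes k :: "'a \<Rightarrow> 'b \<Rightarrow> real" and \<alpha> c r R :: real
  defines "\<beta> \<equiv> \<alpha> / (2 * c)"
  assumes M: "prob_space M" and N: "prob_space N"
    and k[measurable]: "case_prod k \<in> borel_measurable (M \<Otimes>\<^sub>M N)" and k0: "\<And>x y. 0 \<le> k x y"
    and f: "integrable M f" "(\<integral>x. f x \<partial>M) = 0"
    and \<phi>[measurable]: "\<phi> \<in> borel_measurable M" and \<phi>0: "\<And>x. 0 \<le> \<phi> x"
    and \<psi>[measurable]: "\<psi> \<in> borel_measurable N" and \<psi>0: "\<And>y. 0 \<le> \<psi> y"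
    and g[measurable]: "g \<in> borel_measurable N" and g0: "\<And>y. 0 \<le> g y"
    and c: "0 < c" and r: "0 \<le> r" and \<alpha>: "0 < \<alpha>" "\<alpha> \<le> 1" and R: "7 * c + 2 * r \<le> R"
    and mass: "AE x in M. (\<integral>\<^sup>+y. ennreal (k x y) \<partial>N) = 1"
    and lyap: "AE x in M. (\<integral>\<^sup>+y. ennreal (k x y * \<psi> y) \<partial>N) \<le> ennreal (\<phi> x / 4 + c)"
    and minor: "AE x in M. \<phi> x \<le> R \<longrightarrow> (AE y in N. \<alpha> * g y \<le> k x y)"
    and g1: "(\<integral>\<^sup>+y. ennreal (g y) \<partial>N) = 1" and gr: "(\<integral>\<^sup>+y. ennreal (g y * \<psi> y) \<partial>N) \<le> ennreal r"
  shows "(\<integral>\<^sup>+y. ennreal (1 + \<beta> * \<psi> y) * ennreal \<bar>\<integral>x. f x * k x y \<partial>M\<bar> \<partial>N)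
    \<le> ennreal (1 - \<alpha> / 4) * (\<integral>\<^sup>+x. ennreal (1 + \<beta> * \<phi> x) * ennreal \<bar>f x\<bar> \<partial>M)"
proof -
  interpret M: prob_space M by fact
  interpret N: prob_space N by fact
  interpret MN: pair_prob_space M N ..
  note [measurable] = borel_measurable_integrable[OF f(1)]
  have b0: "0 < \<beta>" and bc: "\<beta> * c = \<alpha> / 2" using c \<alpha> by (simp_all add: \<beta>_def)
  have w0: "0 \<le> 1 + \<beta> * \<psi> y" for y using b0 \<psi>0[of y] by simp
  have weighted: "(\<integral>\<^sup>+y. ennreal (h y * (1 + \<beta> * \<psi> y)) \<partial>N)
      = (\<integral>\<^sup>+y. ennreal (h y) \<partial>N) + ennreal \<beta> * (\<integral>\<^sup>+y. ennreal (h y * \<psi> y) \<partial>N)"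
    if [measurable]: "h \<in> borel_measurable N" and h0: "\<And>y. 0 \<le> h y" for h
  proof -
    have "ennreal (h y * (1 + \<beta> * \<psi> y)) = ennreal (h y) + ennreal \<beta> * ennreal (h y * \<psi> y)" for y
      using h0[of y] \<psi>0[of y] b0
      by (simp add: ennreal_mult[symmetric] ennreal_plus[symmetric] algebra_simps del: ennreal_plus)
    then show ?thesis by (simp add: nn_integral_add nn_integral_cmult)
  qed
  have one_plus: "1 + ennreal z = ennreal (1 + z)" if "0 \<le> z" for z
    using that by simp
  define J where "J = (\<integral>\<^sup>+y. ennreal (\<alpha> * g y * (1 + \<beta> * \<psi> y)) \<partial>N)"
  have J: "J = ennreal \<alpha> * (1 + ennreal \<beta> * (\<integral>\<^sup>+y. ennreal (g y * \<psi> y) \<partial>N))"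
  proof -
    have "J = (\<integral>\<^sup>+y. ennreal \<alpha> * ennreal (g y * (1 + \<beta> * \<psi> y)) \<partial>N)"
      unfolding J_def using \<alpha> g0 w0 by (intro nn_integral_cong) (simp add: ennreal_mult[symmetric] mult.assoc)
    then show ?thesis using g0 by (simp add: nn_integral_cmult weighted g1)
  qed
  have J_ge: "ennreal \<alpha> \<le> J"
    unfolding J by (subst mult_1_right[symmetric], rule mult_left_mono) auto
  have J_le: "J \<le> ennreal (\<alpha> * (1 + \<beta> * r))"
  proof -
    have "J \<le> ennreal \<alpha> * (1 + ennreal \<beta> * ennreal r)"
      unfolding J using gr by (intro mult_left_mono add_left_mono) auto
    also have "\<dots> = ennreal (\<alpha> * (1 + \<beta> * r))"
      using \<alpha> b0 r by (simp add: one_plus ennreal_mult[symmetric] del: ennreal_plus)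
    finally show ?thesis .
  qed
  have pointwise: "AE x in M. (\<integral>\<^sup>+y. ennreal (\<bar>k x y - \<alpha> * g y\<bar> * (1 + \<beta> * \<psi> y)) \<partial>N)
      \<le> ennreal ((1 - \<alpha> / 4) * (1 + \<beta> * \<phi> x))"
    using mass lyap minor AE_space
  proof eventually_elim
    case (elim x)
    note x = elim(4)
    have [measurable]: "k x \<in> borel_measurable N" using x by simp
    let ?I = "\<integral>\<^sup>+y. ennreal (\<bar>k x y - \<alpha> * g y\<bar> * (1 + \<beta> * \<psi> y)) \<partial>N"
    let ?X = "1 + \<beta> * (\<phi> x / 4 + c)"
    have "(\<integral>\<^sup>+y. ennreal (k x y * (1 + \<beta> * \<psi> y)) \<partial>N)
        = 1 + ennreal \<beta> * (\<integral>\<^sup>+y. ennreal (k x y * \<psi> y) \<partial>N)"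
      using elim(1) k0 by (simp add: weighted)
    also have "\<dots> \<le> 1 + ennreal \<beta> * ennreal (\<phi> x / 4 + c)"
      using elim(2) by (intro add_left_mono mult_left_mono) auto
    also have "\<dots> = ennreal ?X"
      using b0 c \<phi>0[of x] by (simp add: one_plus ennreal_mult[symmetric] del: ennreal_plus)
    finally have K: "(\<integral>\<^sup>+y. ennreal (k x y * (1 + \<beta> * \<psi> y)) \<partial>N) \<le> ennreal ?X" .
    have bp: "0 \<le> \<beta> * \<phi> x" using b0 \<phi>0[of x] by simp
    have bpa: "\<alpha> * (\<beta> * \<phi> x) \<le> \<beta> * \<phi> x" using \<alpha> bp by (simp add: mult_left_le_one_le)
    have X: "?X = 1 + \<beta> * \<phi> x / 4 + \<alpha> / 2" using bc by (simp add: distrib_left)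
    have Y: "(1 - \<alpha> / 4) * (1 + \<beta> * \<phi> x) = 1 - \<alpha> / 4 + \<beta> * \<phi> x - \<alpha> * (\<beta> * \<phi> x) / 4"
      by (simp add: algebra_simps)
    show ?case
    proof (cases "\<phi> x \<le> R")
      case True
      with elim(3) have m: "AE y in N. \<alpha> * g y \<le> k x y" by simp
      have "?I + J = (\<integral>\<^sup>+y. ennreal (k x y * (1 + \<beta> * \<psi> y)) \<partial>N)"
        unfolding J_def
      proof (subst nn_integral_add[symmetric])
        show "(\<integral>\<^sup>+y. ennreal (\<bar>k x y - \<alpha> * g y\<bar> * (1 + \<beta> * \<psi> y)) + ennreal (\<alpha> * g y * (1 + \<beta> * \<psi> y)) \<partial>N)
          = (\<integral>\<^sup>+y. ennreal (k x y * (1 + \<beta> * \<psi> y)) \<partial>N)"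
          using m
        proof (intro nn_integral_cong_AE, eventually_elim)
          case (elim y)
          have "ennreal (\<bar>k x y - \<alpha> * g y\<bar> * (1 + \<beta> * \<psi> y)) + ennreal (\<alpha> * g y * (1 + \<beta> * \<psi> y))
              = ennreal (\<bar>k x y - \<alpha> * g y\<bar> * (1 + \<beta> * \<psi> y) + \<alpha> * g y * (1 + \<beta> * \<psi> y))"
            using w0[of y] \<alpha> g0[of y] by (intro ennreal_plus[symmetric]) auto
          also have "\<bar>k x y - \<alpha> * g y\<bar> * (1 + \<beta> * \<psi> y) + \<alpha> * g y * (1 + \<beta> * \<psi> y) = k x y * (1 + \<beta> * \<psi> y)"
            using elim by (simp add: distrib_right[symmetric] del: distrib_right_numeral)
          finally show ?case .
        qed
      qed measurable
      then have "?I + ennreal \<alpha> \<le> ennreal ?X"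
        using K add_left_mono[OF J_ge, of ?I] by simp
      then have "?I \<le> ennreal (?X - \<alpha>)"
        by (rule ennreal_le_diff) (use \<alpha> in simp)
      also have "?X - \<alpha> \<le> (1 - \<alpha> / 4) * (1 + \<beta> * \<phi> x)"
        unfolding X Y using bp bpa \<alpha> by linarith
      finally show ?thesis by (simp add: ennreal_leI)
    next
      case False
      have "?I \<le> (\<integral>\<^sup>+y. ennreal (k x y * (1 + \<beta> * \<psi> y)) + ennreal (\<alpha> * g y * (1 + \<beta> * \<psi> y)) \<partial>N)"
      proof (rule nn_integral_mono)
        fix y
        have "\<bar>k x y - \<alpha> * g y\<bar> * (1 + \<beta> * \<psi> y) \<le> (k x y + \<alpha> * g y) * (1 + \<beta> * \<psi> y)"
          using k0[of x y] g0[of y] \<alpha> w0[of y] by (intro mult_right_mono) (auto simp: abs_le_iff)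
        then have "ennreal (\<bar>k x y - \<alpha> * g y\<bar> * (1 + \<beta> * \<psi> y))
            \<le> ennreal (k x y * (1 + \<beta> * \<psi> y) + \<alpha> * g y * (1 + \<beta> * \<psi> y))"
          unfolding distrib_right[of "k x y"] by (rule ennreal_leI)
        also have "\<dots> = ennreal (k x y * (1 + \<beta> * \<psi> y)) + ennreal (\<alpha> * g y * (1 + \<beta> * \<psi> y))"
          using k0[of x y] g0[of y] \<alpha> w0[of y] by (intro ennreal_plus) auto
        finally show "ennreal (\<bar>k x y - \<alpha> * g y\<bar> * (1 + \<beta> * \<psi> y))
            \<le> ennreal (k x y * (1 + \<beta> * \<psi> y)) + ennreal (\<alpha> * g y * (1 + \<beta> * \<psi> y))" .
      qed
      also have "\<dots> = (\<integral>\<^sup>+y. ennreal (k x y * (1 + \<beta> * \<psi> y)) \<partial>N) + J"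
        unfolding J_def by (rule nn_integral_add) measurable
      also have "\<dots> \<le> ennreal ?X + ennreal (\<alpha> * (1 + \<beta> * r))"
        using K J_le by (rule add_mono)
      also have "\<dots> = ennreal (?X + \<alpha> * (1 + \<beta> * r))"
        using b0 c \<phi>0[of x] \<alpha> r by (intro ennreal_plus[symmetric]) auto
      also have "?X + \<alpha> * (1 + \<beta> * r) \<le> (1 - \<alpha> / 4) * (1 + \<beta> * \<phi> x)"
      proof -
        have "\<beta> * (7 * c + 2 * r) \<le> \<beta> * \<phi> x"
          using False R b0 by (intro mult_left_mono) auto
        moreover have "\<beta> * (7 * c + 2 * r) = 7 * (\<beta> * c) + 2 * (\<beta> * r)" by (simp add: algebra_simps)
        ultimately have "7 * (\<alpha> / 2) + 2 * (\<beta> * r) \<le> \<beta> * \<phi> x" unfolding bc by simp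
        moreover have "\<alpha> * (\<beta> * r) \<le> \<beta> * r"
          using \<alpha> b0 r by (intro mult_left_le_one_le) auto
        moreover have "\<alpha> * (1 + \<beta> * r) = \<alpha> + \<alpha> * (\<beta> * r)" by (simp add: distrib_left)
        ultimately show ?thesis unfolding X Y using bp bpa \<alpha> by linarith
      qed
      finally show ?thesis by (simp add: ennreal_leI)
    qed
  qed
  have swap: "(\<integral>\<^sup>+y. \<integral>\<^sup>+x. ennreal \<bar>f x\<bar> * ennreal (h x y) \<partial>M \<partial>N)
      = (\<integral>\<^sup>+x. ennreal \<bar>f x\<bar> * (\<integral>\<^sup>+y. ennreal (h x y) \<partial>N) \<partial>M)"
    if [measurable]: "case_prod h \<in> borel_measurable (M \<Otimes>\<^sub>M N)" for h
  proof -
    have "(\<integral>\<^sup>+y. \<integral>\<^sup>+x. ennreal \<bar>f x\<bar> * ennreal (h x y) \<partial>M \<partial>N)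
        = (\<integral>\<^sup>+x. \<integral>\<^sup>+y. ennreal \<bar>f x\<bar> * ennreal (h x y) \<partial>N \<partial>M)"
      by (rule MN.Fubini') measurable
    then show ?thesis by (simp add: nn_integral_cmult cong: nn_integral_cong)
  qed
  have fin: "(\<integral>\<^sup>+x. ennreal \<bar>f x\<bar> \<partial>M) < \<infinity>"
    using f(1) by (simp add: integrable_iff_bounded)
  have "(\<integral>\<^sup>+y. \<integral>\<^sup>+x. ennreal \<bar>f x\<bar> * ennreal (k x y) \<partial>M \<partial>N) = (\<integral>\<^sup>+x. ennreal \<bar>f x\<bar> \<partial>M)"
    using mass by (subst swap) (auto intro!: nn_integral_cong_AE)
  then have "AE y in N. (\<integral>\<^sup>+x. ennreal \<bar>f x\<bar> * ennreal (k x y) \<partial>M) \<noteq> \<infinity>"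
    using fin by (intro nn_integral_PInf_AE) auto
  then have bound: "AE y in N. ennreal \<bar>\<integral>x. f x * k x y \<partial>M\<bar>
      \<le> (\<integral>\<^sup>+x. ennreal \<bar>f x\<bar> * ennreal \<bar>k x y - \<alpha> * g y\<bar> \<partial>M)"
    using AE_space
  proof eventually_elim
    case (elim y)
    have [measurable]: "(\<lambda>x. k x y) \<in> borel_measurable M" using elim(2) by simp
    have i: "integrable M (\<lambda>x. f x * k x y)"
      using elim(1) k0 by (intro integrableI_bounded)
        (auto simp: abs_mult ennreal_mult less_top)
    have i': "integrable M (\<lambda>x. f x * (\<alpha> * g y))" using f(1) by simp
    \<comment> \<open>This is the only place where \<open>f\<close> has to be centred.\<close>
    have "(\<integral>x. f x * k x y \<partial>M) = (\<integral>x. f x * k x y - f x * (\<alpha> * g y) \<partial>M)"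
      using f by (subst Bochner_Integration.integral_diff[OF i i']) simp
    also have "\<dots> = (\<integral>x. f x * (k x y - \<alpha> * g y) \<partial>M)"
      by (simp add: right_diff_distrib)
    finally have "ennreal \<bar>\<integral>x. f x * k x y \<partial>M\<bar> = ennreal (norm (\<integral>x. f x * (k x y - \<alpha> * g y) \<partial>M))"
      by simp
    also have "\<dots> \<le> (\<integral>\<^sup>+x. ennreal (norm (f x * (k x y - \<alpha> * g y))) \<partial>M)"
      using Bochner_Integration.integrable_diff[OF i i']
      by (intro integral_norm_bound_ennreal) (simp add: right_diff_distrib)
    finally show ?case by (simp add: abs_mult ennreal_mult)
  qed
  have "(\<integral>\<^sup>+y. ennreal (1 + \<beta> * \<psi> y) * ennreal \<bar>\<integral>x. f x * k x y \<partial>M\<bar> \<partial>N)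
      \<le> (\<integral>\<^sup>+y. ennreal (1 + \<beta> * \<psi> y) * (\<integral>\<^sup>+x. ennreal \<bar>f x\<bar> * ennreal \<bar>k x y - \<alpha> * g y\<bar> \<partial>M) \<partial>N)"
    using bound by (intro nn_integral_mono_AE, eventually_elim) (rule mult_left_mono, simp_all)
  also have "\<dots> = (\<integral>\<^sup>+y. \<integral>\<^sup>+x. ennreal \<bar>f x\<bar> * ennreal (\<bar>k x y - \<alpha> * g y\<bar> * (1 + \<beta> * \<psi> y)) \<partial>M \<partial>N)"
    using w0 by (intro nn_integral_cong)
      (simp add: nn_integral_cmult[symmetric] ennreal_mult mult_ac)
  also have "\<dots> = (\<integral>\<^sup>+x. ennreal \<bar>f x\<bar> * (\<integral>\<^sup>+y. ennreal (\<bar>k x y - \<alpha> * g y\<bar> * (1 + \<beta> * \<psi> y)) \<partial>N) \<partial>M)"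
    by (rule swap) measurable
  also have "\<dots> \<le> (\<integral>\<^sup>+x. ennreal \<bar>f x\<bar> * ennreal ((1 - \<alpha> / 4) * (1 + \<beta> * \<phi> x)) \<partial>M)"
    using pointwise by (intro nn_integral_mono_AE, eventually_elim) (rule mult_left_mono, simp_all)
  also have "\<dots> = (\<integral>\<^sup>+x. ennreal (1 - \<alpha> / 4) * (ennreal (1 + \<beta> * \<phi> x) * ennreal \<bar>f x\<bar>) \<partial>M)"
    using \<alpha> b0 \<phi>0 by (intro nn_integral_cong) (simp add: ennreal_mult mult_ac)
  also have "\<dots> = ennreal (1 - \<alpha> / 4) * (\<integral>\<^sup>+x. ennreal (1 + \<beta> * \<phi> x) * ennreal \<bar>f x\<bar> \<partial>M)"
    by (rule nn_integral_cmult) measurable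
  finally show ?thesis .
qed

section \<open>The log-integral transform\<close>

text \<open>The setting after \<open>exp (- U)\<close> and \<open>exp (- V)\<close> have been absorbed into the reference
  probabilities.  It is invariant under exchange of the two spaces, so each result also serves
  for the other half-step of the iteration.\<close>

locale coupled_cost =
  fixes M :: "'a measure" and N :: "'b measure" and W :: "'a \<Rightarrow> 'b \<Rightarrow> real" and C :: real
  assumes prob_M: "prob_space M" and prob_N: "prob_space N"
    and W_measurable[measurable]: "case_prod W \<in> borel_measurable (M \<Otimes>\<^sub>M N)"
    and C_ge_1: "1 \<le> C"
    and exp_W_le: "AE x in M. AE y in N. exp (- W x y) \<le> C"
    and integrable_W_left: "\<And>x. x \<in> space M \<Longrightarrow> integrable N (\<lambda>y. W x y)"
    and integrable_W_right: "\<And>y. y \<in> space N \<Longrightarrow> integrable M (\<lambda>x. W x y)"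
begin

sublocale M: prob_space M by (rule prob_M)
sublocale N: prob_space N by (rule prob_N)
sublocale MN: pair_prob_space M N ..

lemma exp_W_le': "AE y in N. AE x in M. exp (- W x y) \<le> C"
  using exp_W_le by (subst MN.AE_commute[symmetric]) simp_all

lemma swapped: "coupled_cost N M (\<lambda>y x. W x y) C"
proof
  show "(\<lambda>(y, x). W x y) \<in> borel_measurable (N \<Otimes>\<^sub>M M)"
    by measurable
qed (use C_ge_1 exp_W_le' integrable_W_left integrable_W_right in auto)

end

text \<open>One half-step of the Sinkhorn iteration, for centred potentials.\<close>

definition log_integral_transform ::
  "'a measure \<Rightarrow> ('a \<Rightarrow> 'b \<Rightarrow> real) \<Rightarrow> ('a \<Rightarrow> real) \<Rightarrow> 'b \<Rightarrow> real" where
  "log_integral_transform M W u y = ln (\<integral>x. exp (- W x y - u x) \<partial>M)"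

text \<open>The logarithm returns a conventional value where the integral diverges; this relation says that
  \<open>v\<close> is the half-step of \<open>u\<close> and that such points form a null set.\<close>

definition proper_transform ::
  "'a measure \<Rightarrow> 'b measure \<Rightarrow> ('a \<Rightarrow> 'b \<Rightarrow> real) \<Rightarrow> ('a \<Rightarrow> real) \<Rightarrow> ('b \<Rightarrow> real) \<Rightarrow> bool" where
  "proper_transform M N W u v \<longleftrightarrow> u \<in> borel_measurable M \<and> v \<in> borel_measurable N \<and>
    (AE y in N. integrable M (\<lambda>x. exp (- W x y - u x)) \<and>
       exp (v y) = (\<integral>x. exp (- W x y - u x) \<partial>M))"

text \<open>Jensen's inequality for the exponential, from its tangent line at the mean.\<close>

lemma (in prob_space) exp_integral_le:
  fixes f :: "'a \<Rightarrow> real"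
  assumes f: "integrable M f" and e: "integrable M (\<lambda>x. exp (f x))"
  shows "exp (\<integral>x. f x \<partial>M) \<le> (\<integral>x. exp (f x) \<partial>M)"
proof -
  let ?m = "\<integral>x. f x \<partial>M"
  have "exp ?m * (1 + (f x - ?m)) \<le> exp (f x)" for x
  proof -
    have "exp ?m * (1 + (f x - ?m)) \<le> exp ?m * exp (f x - ?m)"
      by (intro mult_left_mono exp_ge_add_one_self) auto
    then show ?thesis by (simp add: exp_diff)
  qed
  then have "(\<integral>x. exp ?m * (1 + (f x - ?m)) \<partial>M) \<le> (\<integral>x. exp (f x) \<partial>M)"
    using f e by (intro integral_mono) auto
  then show ?thesis using f by (simp add: prob_space)
qed

context coupled_cost
begin

lemma log_integral_transform_measurable[measurable]:
  assumes [measurable]: "u \<in> borel_measurable M"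
  shows "log_integral_transform M W u \<in> borel_measurable N"
  unfolding log_integral_transform_def by measurable

text \<open>The lower bound is Jensen's inequality; the upper one, and the convergence of the integral
  itself, come from the bound on \<open>exp (- W)\<close>.\<close>

lemma log_integral_transform_bounds:
  assumes u[measurable]: "u \<in> borel_measurable M"
    and iu: "integrable M u" and ieu: "integrable M (\<lambda>x. exp (- u x))"
  shows "proper_transform M N W u (log_integral_transform M W u)"
    and "AE y in N. - (\<integral>x. W x y \<partial>M) - (\<integral>x. u x \<partial>M) \<le> log_integral_transform M W u y \<and>
      log_integral_transform M W u y \<le> ln (C * (\<integral>x. exp (- u x) \<partial>M))"
proof -
  have *: "AE y in N. integrable M (\<lambda>x. exp (- W x y - u x)) \<and>
      exp (log_integral_transform M W u y) = (\<integral>x. exp (- W x y - u x) \<partial>M) \<and>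
      - (\<integral>x. W x y \<partial>M) - (\<integral>x. u x \<partial>M) \<le> log_integral_transform M W u y \<and>
      log_integral_transform M W u y \<le> ln (C * (\<integral>x. exp (- u x) \<partial>M))"
    using exp_W_le' AE_space
  proof eventually_elim
    case (elim y)
    note iW = integrable_W_right[OF elim(2)]
    have [measurable]: "(\<lambda>x. W x y) \<in> borel_measurable M" using elim(2) by simp
    have le: "AE x in M. exp (- W x y - u x) \<le> C * exp (- u x)"
      using elim(1) by eventually_elim (simp add: exp_diff exp_minus divide_simps)
    have iC: "integrable M (\<lambda>x. C * exp (- u x))" using ieu by simp
    have i: "integrable M (\<lambda>x. exp (- W x y - u x))"
      by (rule Bochner_Integration.integrable_bound[OF iC]) (use le in auto)
    have "exp (- (\<integral>x. W x y \<partial>M) - (\<integral>x. u x \<partial>M)) = exp (\<integral>x. - W x y - u x \<partial>M)"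
      using iW iu by simp
    also have "\<dots> \<le> (\<integral>x. exp (- W x y - u x) \<partial>M)"
      using iW iu i by (intro M.exp_integral_le) auto
    finally have lo: "exp (- (\<integral>x. W x y \<partial>M) - (\<integral>x. u x \<partial>M)) \<le> (\<integral>x. exp (- W x y - u x) \<partial>M)" .
    then have pos: "0 < (\<integral>x. exp (- W x y - u x) \<partial>M)" by (meson exp_gt_zero less_le_trans)
    have hi: "(\<integral>x. exp (- W x y - u x) \<partial>M) \<le> C * (\<integral>x. exp (- u x) \<partial>M)"
      using integral_mono_AE[OF i iC le] by simp
    show ?case
      using i pos lo hi by (auto simp: log_integral_transform_def ln_ge_iff)
  qed
  show "proper_transform M N W u (log_integral_transform M W u)"
    using * unfolding proper_transform_def by (auto elim: eventually_mono)
  show "AE y in N. - (\<integral>x. W x y \<partial>M) - (\<integral>x. u x \<partial>M) \<le> log_integral_transform M W u y \<and>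
      log_integral_transform M W u y \<le> ln (C * (\<integral>x. exp (- u x) \<partial>M))"
    using * by (auto elim: eventually_mono)
qed

lemma exp_factor:
  fixes w a b :: real
  shows "exp (- a) * exp (- w - b) = exp (- w - a - b)" "exp (- b) * exp (- w - a) = exp (- w - a - b)"
  by (simp_all add: exp_add[symmetric])

lemma nn_integral_proper_transform:
  assumes "proper_transform M N W u v"
  shows "AE y in N. (\<integral>\<^sup>+x. ennreal (exp (- W x y - u x)) \<partial>M) = ennreal (exp (v y))"
proof -
  have "AE y in N. integrable M (\<lambda>x. exp (- W x y - u x)) \<and>
      exp (v y) = (\<integral>x. exp (- W x y - u x) \<partial>M)"
    using assms by (simp add: proper_transform_def)
  then show ?thesis by eventually_elim (simp add: nn_integral_eq_integral)
qed

text \<open>The double integral of \<open>exp (- W x y - u x - v y)\<close> is evaluated in either order: integration over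
  \<open>y\<close> first gives \<open>exp (u' - u)\<close>, integration over \<open>x\<close> first gives \<open>1\<close>.\<close>

lemma round_trip_mass:
  assumes uv: "proper_transform M N W u v" and vu: "proper_transform N M (\<lambda>y x. W x y) v u'"
  shows "(\<integral>\<^sup>+x. ennreal (exp (u' x - u x)) \<partial>M) = 1"
proof -
  interpret S: coupled_cost N M "\<lambda>y x. W x y" C by (rule swapped)
  have [measurable]: "u \<in> borel_measurable M" "v \<in> borel_measurable N" "u' \<in> borel_measurable M"
    using uv vu by (simp_all add: proper_transform_def)
  have "(\<integral>\<^sup>+x. ennreal (exp (u' x - u x)) \<partial>M)
      = (\<integral>\<^sup>+x. ennreal (exp (- u x)) * (\<integral>\<^sup>+y. ennreal (exp (- W x y - v y)) \<partial>N) \<partial>M)"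
    using S.nn_integral_proper_transform[OF vu]
    by (intro nn_integral_cong_AE, eventually_elim) (simp add: ennreal_mult[symmetric] exp_add[symmetric])
  also have "\<dots> = (\<integral>\<^sup>+x. \<integral>\<^sup>+y. ennreal (exp (- W x y - u x - v y)) \<partial>N \<partial>M)"
    by (intro nn_integral_cong)
      (simp add: nn_integral_cmult[symmetric] ennreal_mult[symmetric] exp_factor)
  also have "\<dots> = (\<integral>\<^sup>+y. \<integral>\<^sup>+x. ennreal (exp (- W x y - u x - v y)) \<partial>M \<partial>N)"
    by (rule MN.Fubini'[symmetric]) measurable
  also have "\<dots> = (\<integral>\<^sup>+y. ennreal (exp (- v y)) * (\<integral>\<^sup>+x. ennreal (exp (- W x y - u x)) \<partial>M) \<partial>N)"
    by (intro nn_integral_cong)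
      (simp add: nn_integral_cmult[symmetric] ennreal_mult[symmetric] exp_factor(2))
  also have "\<dots> = (\<integral>\<^sup>+y. 1 \<partial>N)"
    using nn_integral_proper_transform[OF uv]
    by (intro nn_integral_cong_AE, eventually_elim) (simp add: ennreal_mult[symmetric] exp_add[symmetric])
  finally show ?thesis by (simp add: N.emeasure_space_1)
qed

text \<open>Jensen's inequality applied to \<open>u' - u\<close>, whose exponential has integral \<open>1\<close>.  This is the
  monotonicity of the relative entropy along the Sinkhorn iteration.\<close>

lemma round_trip_decreases_integral:
  assumes uv: "proper_transform M N W u v" and vu: "proper_transform N M (\<lambda>y x. W x y) v u'"
    and i: "integrable M u" "integrable M u'"
  shows "(\<integral>x. u' x \<partial>M) \<le> (\<integral>x. u x \<partial>M)"
proof -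
  have [measurable]: "u \<in> borel_measurable M" "u' \<in> borel_measurable M"
    using uv vu by (simp_all add: proper_transform_def)
  have ie: "integrable M (\<lambda>x. exp (u' x - u x))"
    using round_trip_mass[OF uv vu] by (intro integrableI_nonneg) auto
  have "(\<integral>x. exp (u' x - u x) \<partial>M) = 1"
    using round_trip_mass[OF uv vu] by (subst integral_eq_nn_integral) auto
  then have "exp (\<integral>x. u' x - u x \<partial>M) \<le> 1"
    using M.exp_integral_le[OF Bochner_Integration.integrable_diff[OF i(2,1)] ie] by simp
  then show ?thesis using i by simp
qed

text \<open>The first term under the integral is \<open>exp (- v y)\<close> times the integrand that defines \<open>v\<close>, the second
  one \<open>exp (- v y)\<close> times the integrand that defines \<open>v'\<close>.\<close>

lemma kernel_maps_deviation:
  assumes uv: "proper_transform M N W u v" and vu: "proper_transform N M (\<lambda>y x. W x y) v u'"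
    and uv': "proper_transform M N W u' v'"
  shows "AE y in N. (\<integral>x. (exp (u' x - u x) - 1) * exp (- W x y - u' x - v y) \<partial>M)
      = 1 - exp (v' y - v y)"
proof -
  have "AE y in N. integrable M (\<lambda>x. exp (- W x y - u x)) \<and>
      exp (v y) = (\<integral>x. exp (- W x y - u x) \<partial>M)"
    "AE y in N. integrable M (\<lambda>x. exp (- W x y - u' x)) \<and>
      exp (v' y) = (\<integral>x. exp (- W x y - u' x) \<partial>M)"
    using uv uv' by (auto simp: proper_transform_def)
  then show ?thesis
  proof eventually_elim
    case (elim y)
    have "(\<lambda>x. (exp (u' x - u x) - 1) * exp (- W x y - u' x - v y)) =
        (\<lambda>x. exp (- v y) * (exp (- W x y - u x) - exp (- W x y - u' x)))"
      by (rule ext) (simp add: algebra_simps exp_add[symmetric] exp_diff exp_minus field_simps)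
    moreover have "(\<integral>x. exp (- v y) * (exp (- W x y - u x) - exp (- W x y - u' x)) \<partial>M)
        = exp (- v y) * (exp (v y) - exp (v' y))"
      using elim by simp
    ultimately show ?case
      by (simp add: algebra_simps exp_add[symmetric])
  qed
qed

lemma kernel_mass:
  assumes "proper_transform N M (\<lambda>y x. W x y) v u"
  shows "AE x in M. (\<integral>\<^sup>+y. ennreal (exp (- W x y - u x - v y)) \<partial>N) = 1"
proof -
  interpret S: coupled_cost N M "\<lambda>y x. W x y" C by (rule swapped)
  have [measurable]: "v \<in> borel_measurable N" using assms by (simp add: proper_transform_def)
  show ?thesis
    using S.nn_integral_proper_transform[OF assms] AE_space
  proof eventually_elim
    case (elim x)
    have [measurable]: "W x \<in> borel_measurable N" using elim(2) by simp
    have "(\<integral>\<^sup>+y. ennreal (exp (- W x y - u x - v y)) \<partial>N)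
        = (\<integral>\<^sup>+y. ennreal (exp (- u x)) * ennreal (exp (- W x y - v y)) \<partial>N)"
      by (simp add: ennreal_mult[symmetric] exp_factor)
    also have "\<dots> = ennreal (exp (- u x)) * ennreal (exp (u x))"
      using elim(1) by (subst nn_integral_cmult) auto
    finally show ?case by (simp add: ennreal_mult[symmetric] exp_add[symmetric])
  qed
qed

end

context coupled_cost
begin

lemma prob_space_round_trip_density:
  assumes uv: "proper_transform M N W u v" and vu: "proper_transform N M (\<lambda>y x. W x y) v u'"
  shows "prob_space (density M (\<lambda>x. ennreal (exp (u' x - u x))))"
proof (rule prob_spaceI)
  have [measurable]: "u \<in> borel_measurable M" "u' \<in> borel_measurable M"
    using uv vu by (simp_all add: proper_transform_def)
  show "emeasure (density M (\<lambda>x. ennreal (exp (u' x - u x))))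
      (space (density M (\<lambda>x. ennreal (exp (u' x - u x))))) = 1"
    using round_trip_mass[OF uv vu] by (simp add: emeasure_density cong: nn_integral_cong)
qed

text \<open>The marginal after one Sinkhorn step.  For almost every \<open>x\<close> the normalising integral is
  \<open>exp (u x)\<close>, and then integration over \<open>x\<close> produces \<open>exp (v' y)\<close>.\<close>

lemma bind_normalised_kernel:
  assumes vu: "proper_transform N M (\<lambda>y x. W x y) v u" and uv: "proper_transform M N W u v'"
  shows "M \<bind> (\<lambda>x. density N (\<lambda>y. ennreal (exp (- W x y - v y) / (\<integral>z. exp (- W x z - v z) \<partial>N))))
    = density N (\<lambda>y. ennreal (exp (v' y - v y)))"
proof -
  have [measurable]: "u \<in> borel_measurable M" "v \<in> borel_measurable N" "v' \<in> borel_measurable N"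
    using vu uv by (simp_all add: proper_transform_def)
  let ?Z = "\<lambda>x. \<integral>z. exp (- W x z - v z) \<partial>N"
  let ?k = "\<lambda>x y. ennreal (exp (- W x y - v y) / ?Z x)"
  have "M \<bind> (\<lambda>x. density N (?k x)) = density N (\<lambda>y. \<integral>\<^sup>+x. ?k x y \<partial>M)"
  proof (rule bind_density_eq_density[OF prob_M N.sigma_finite_measure_axioms])
    show "case_prod ?k \<in> borel_measurable (M \<Otimes>\<^sub>M N)" by measurable
    fix x assume x: "x \<in> space M"
    have [measurable]: "W x \<in> borel_measurable N" using x by simp
    show "subprob_space (density N (?k x))"
    proof (rule subprob_spaceI)
      show "emeasure (density N (?k x)) (space (density N (?k x))) \<le> 1"
      \<comment> \<open>Where the normalising integral diverges its value is \<open>0\<close>, and the kernel is the null measure.\<close>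
      proof (cases "?Z x = 0")
        case True
        then show ?thesis by (simp add: emeasure_density)
      next
        case False
        then have i: "integrable N (\<lambda>z. exp (- W x z - v z))"
          by (meson not_integrable_integral_eq)
        have "(\<integral>\<^sup>+y. ?k x y \<partial>N) = ennreal (\<integral>y. exp (- W x y - v y) / ?Z x \<partial>N)"
          using i by (intro nn_integral_eq_integral) (auto intro!: divide_nonneg_nonneg)
        then show ?thesis using False by (simp add: emeasure_density cong: nn_integral_cong)
      qed
    qed (simp add: N.not_empty)
  qed
  also have "\<dots> = density N (\<lambda>y. ennreal (exp (v' y - v y)))"
  proof (rule density_cong)
    have Z: "AE x in M. ?Z x = exp (u x)"
      using vu unfolding proper_transform_def by (elim conjE eventually_mono) simp
    show "AE y in N. (\<integral>\<^sup>+x. ?k x y \<partial>M) = ennreal (exp (v' y - v y))"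
      using nn_integral_proper_transform[OF uv] AE_space
    proof eventually_elim
      case (elim y)
      have [measurable]: "(\<lambda>x. W x y) \<in> borel_measurable M" using elim(2) by simp
      have "(\<integral>\<^sup>+x. ?k x y \<partial>M) = (\<integral>\<^sup>+x. ennreal (exp (- v y)) * ennreal (exp (- W x y - u x)) \<partial>M)"
        using Z by (intro nn_integral_cong_AE, eventually_elim)
          (simp add: ennreal_mult[symmetric] exp_diff exp_minus field_simps)
      also have "\<dots> = ennreal (exp (- v y)) * ennreal (exp (v' y))"
        using elim(1) by (subst nn_integral_cmult) auto
      finally show ?case by (simp add: ennreal_mult[symmetric] exp_add[symmetric])
    qed
  qed measurable
  finally show ?thesis .
qed

end

section \<open>Bounds on the potentials that are uniform in the iteration\<close>

text \<open>What the argument needs of the weights, which in the application are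
  \<open>\<phi> = exp (\<delta> (U - inf U))\<close> and \<open>\<psi> = exp (\<delta> (V - inf V))\<close>: the integrated costs have
  exponential moments against the weights, their exponentials are of smaller order than the
  weights, and \<open>W\<close> is bounded above on products of sublevel sets of the weights.\<close>

locale weighted_cost = coupled_cost M N W C
  for M :: "'a measure" and N :: "'b measure" and W :: "'a \<Rightarrow> 'b \<Rightarrow> real" and C :: real +
  fixes \<phi> :: "'a \<Rightarrow> real" and \<psi> :: "'b \<Rightarrow> real"
  assumes \<phi>_measurable[measurable]: "\<phi> \<in> borel_measurable M"
    and \<psi>_measurable[measurable]: "\<psi> \<in> borel_measurable N"
    and \<phi>_ge_1: "\<And>x. 1 \<le> \<phi> x" and \<psi>_ge_1: "\<And>y. 1 \<le> \<psi> y"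
    and integrable_exp_left: "integrable M (\<lambda>x. exp (\<integral>y. W x y \<partial>N) * \<phi> x)"
    and integrable_exp_right: "integrable N (\<lambda>y. exp (\<integral>x. W x y \<partial>M) * \<psi> y)"
    and exp_left_small: "\<And>\<epsilon>. 0 < \<epsilon> \<Longrightarrow> \<exists>c. \<forall>x. exp (\<integral>y. W x y \<partial>N) \<le> \<epsilon> * \<phi> x + c"
    and exp_right_small: "\<And>\<epsilon>. 0 < \<epsilon> \<Longrightarrow> \<exists>c. \<forall>y. exp (\<integral>x. W x y \<partial>M) \<le> \<epsilon> * \<psi> y + c"
    and W_bounded: "\<And>R. \<exists>w. \<forall>x y. \<phi> x \<le> R \<longrightarrow> \<psi> y \<le> R \<longrightarrow> W x y \<le> w"
begin

lemma swapped_weighted: "weighted_cost N M (\<lambda>y x. W x y) C \<psi> \<phi>"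
proof -
  interpret S: coupled_cost N M "\<lambda>y x. W x y" C by (rule swapped)
  show ?thesis
  proof
    show "\<exists>w. \<forall>y x. \<psi> y \<le> R \<longrightarrow> \<phi> x \<le> R \<longrightarrow> W x y \<le> w" for R
      using W_bounded[of R] by blast
  qed (use \<phi>_measurable \<psi>_measurable \<phi>_ge_1 \<psi>_ge_1 integrable_exp_left integrable_exp_right
        exp_left_small exp_right_small in auto)
qed

lemma mean_cost_measurable[measurable]: "(\<lambda>x. \<integral>y. W x y \<partial>N) \<in> borel_measurable M"
  by measurable

lemma mean_cost_ge: "AE x in M. - ln C \<le> (\<integral>y. W x y \<partial>N)"
  using exp_W_le AE_space
proof eventually_elim
  case (elim x)
  have "AE y in N. - ln C \<le> W x y"
    using elim(1)
  proof eventually_elim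
    case (elim y)
    then have "ln (exp (- W x y)) \<le> ln C" using C_ge_1 by (intro ln_mono) auto
    then show ?case by simp
  qed
  then have "(\<integral>y. - ln C \<partial>N) \<le> (\<integral>y. W x y \<partial>N)"
    by (intro integral_mono_AE integrable_W_left elim) auto
  then show ?case by (simp add: N.prob_space)
qed

lemma integrable_exp_mean_cost: "integrable M (\<lambda>x. exp (\<integral>y. W x y \<partial>N))"
  by (rule Bochner_Integration.integrable_bound[OF integrable_exp_left])
    (use \<phi>_ge_1 order_trans[OF zero_le_one \<phi>_ge_1] in \<open>auto simp: abs_mult\<close>)

lemma integrable_mean_cost: "integrable M (\<lambda>x. \<integral>y. W x y \<partial>N)"
proof (rule Bochner_Integration.integrable_bound)
  show "integrable M (\<lambda>x. ln C + exp (\<integral>y. W x y \<partial>N))"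
    using integrable_exp_mean_cost by simp
  show "AE x in M. norm (\<integral>y. W x y \<partial>N) \<le> norm (ln C + exp (\<integral>y. W x y \<partial>N))"
    using mean_cost_ge
  proof eventually_elim
    case (elim x)
    have "0 \<le> ln C" using C_ge_1 by simp
    moreover have "(\<integral>y. W x y \<partial>N) \<le> exp (\<integral>y. W x y \<partial>N)"
      using exp_ge_add_one_self[of "\<integral>y. W x y \<partial>N"] by linarith
    moreover have "0 < exp (\<integral>y. W x y \<partial>N)" by simp
    ultimately have "\<bar>\<integral>y. W x y \<partial>N\<bar> \<le> ln C + exp (\<integral>y. W x y \<partial>N)"
      using elim by linarith
    then show ?case by simp
  qed
qed simp

text \<open>A lower bound on \<open>u\<close> by \<open>- W\<^sup>V\<close> makes \<open>exp (- u)\<close> integrable, and therefore bounds the next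
  potential from both sides.\<close>

lemma half_step:
  assumes u[measurable]: "u \<in> borel_measurable M" and iu: "integrable M u"
    and lower: "AE x in M. - (\<integral>y. W x y \<partial>N) - K \<le> u x"
  defines "v \<equiv> log_integral_transform M W u"
  shows "proper_transform M N W u v" "integrable N v"
    "AE y in N. - (\<integral>x. W x y \<partial>M) - (\<integral>x. u x \<partial>M) \<le> v y"
    "AE y in N. v y \<le> ln (C * (exp K * (\<integral>x. exp (\<integral>y. W x y \<partial>N) \<partial>M)))"
    "AE y in N. v y \<le> ln (C * (\<integral>x. exp (- u x) \<partial>M))"
proof -
  interpret S: weighted_cost N M "\<lambda>y x. W x y" C \<psi> \<phi> by (rule swapped_weighted)
  let ?A = "\<integral>x. exp (\<integral>y. W x y \<partial>N) \<partial>M"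
  have iA: "integrable M (\<lambda>x. exp K * exp (\<integral>y. W x y \<partial>N))"
    using integrable_exp_mean_cost by simp
  have le: "AE x in M. exp (- u x) \<le> exp K * exp (\<integral>y. W x y \<partial>N)"
    using lower by eventually_elim (simp flip: exp_add)
  have ie: "integrable M (\<lambda>x. exp (- u x))"
    by (rule Bochner_Integration.integrable_bound[OF iA]) (use le in auto)
  note b = log_integral_transform_bounds[OF u iu ie, folded v_def]
  have "exp (\<integral>x. - u x \<partial>M) \<le> (\<integral>x. exp (- u x) \<partial>M)"
    using iu ie by (intro M.exp_integral_le) auto
  then have pos: "0 < (\<integral>x. exp (- u x) \<partial>M)" by (meson exp_gt_zero less_le_trans)
  have "(\<integral>x. exp (- u x) \<partial>M) \<le> exp K * ?A"
    using integral_mono_AE[OF ie iA le] by simp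
  then have L: "ln (C * (\<integral>x. exp (- u x) \<partial>M)) \<le> ln (C * (exp K * ?A))"
    using C_ge_1 pos by (intro ln_mono) (auto intro!: mult_pos_pos mult_left_mono)
  show "proper_transform M N W u v" by (rule b)
  show lo: "AE y in N. - (\<integral>x. W x y \<partial>M) - (\<integral>x. u x \<partial>M) \<le> v y"
    using b(2) by eventually_elim simp
  show hi: "AE y in N. v y \<le> ln (C * (\<integral>x. exp (- u x) \<partial>M))"
    using b(2) by eventually_elim simp
  show "AE y in N. v y \<le> ln (C * (exp K * ?A))"
    using hi by eventually_elim (use L in linarith)
  show "integrable N v"
  proof (rule Bochner_Integration.integrable_bound)
    show "integrable N (\<lambda>y. \<bar>\<integral>x. W x y \<partial>M\<bar> + \<bar>\<integral>x. u x \<partial>M\<bar> + \<bar>ln (C * (\<integral>x. exp (- u x) \<partial>M))\<bar>)"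
      using S.integrable_mean_cost by simp
    show "v \<in> borel_measurable N" unfolding v_def by measurable
    show "AE y in N. norm (v y)
        \<le> norm (\<bar>\<integral>x. W x y \<partial>M\<bar> + \<bar>\<integral>x. u x \<partial>M\<bar> + \<bar>ln (C * (\<integral>x. exp (- u x) \<partial>M))\<bar>)"
      using lo hi by eventually_elim (simp add: abs_if split: if_splits)
  qed
qed

end

text \<open>The centred potentials \<open>U\<^bsub>2n\<^esub> - U\<close> and \<open>V\<^bsub>2n+1\<^esub> - V\<close>.\<close>

primrec iterated_potential :: "'a measure \<Rightarrow> 'b measure \<Rightarrow> ('a \<Rightarrow> 'b \<Rightarrow> real) \<Rightarrow> nat \<Rightarrow> 'a \<Rightarrow> real" where
  "iterated_potential M N W 0 = (\<lambda>x. 0)"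
| "iterated_potential M N W (Suc n) = log_integral_transform N (\<lambda>y x. W x y)
    (log_integral_transform M W (iterated_potential M N W n))"

definition dual_potential :: "'a measure \<Rightarrow> 'b measure \<Rightarrow> ('a \<Rightarrow> 'b \<Rightarrow> real) \<Rightarrow> nat \<Rightarrow> 'b \<Rightarrow> real" where
  "dual_potential M N W n = log_integral_transform M W (iterated_potential M N W n)"

text \<open>The two-sided bounds under which the kernels contract uniformly: below, minus the integrated
  cost up to a constant; above, a constant.\<close>

definition tame_potential ::
  "'a measure \<Rightarrow> 'b measure \<Rightarrow> ('a \<Rightarrow> 'b \<Rightarrow> real) \<Rightarrow> real \<Rightarrow> real \<Rightarrow> ('a \<Rightarrow> real) \<Rightarrow> bool" where
  "tame_potential M N W K L u \<longleftrightarrow> u \<in> borel_measurable M \<and>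
    (AE x in M. - (\<integral>y. W x y \<partial>N) - K \<le> u x) \<and> (AE x in M. u x \<le> L)"

text \<open>The quantifiers over \<open>u\<close> and \<open>v\<close> stand inside, with the weight and the rate fixed: this is what
  makes the rate independent of the iteration step.\<close>

definition contracts_deviations ::
  "'a measure \<Rightarrow> 'b measure \<Rightarrow> ('a \<Rightarrow> 'b \<Rightarrow> real) \<Rightarrow> ('a \<Rightarrow> real) \<Rightarrow> ('b \<Rightarrow> real) \<Rightarrow>
   real \<Rightarrow> real \<Rightarrow> real \<Rightarrow> real \<Rightarrow> bool" where
  "contracts_deviations M N W \<phi> \<psi> K L \<beta> \<rho> \<longleftrightarrow>
    (\<forall>u v f. tame_potential M N W K L u \<longrightarrow> tame_potential N M (\<lambda>y x. W x y) K L v \<longrightarrow>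
       (AE x in M. (\<integral>\<^sup>+y. ennreal (exp (- W x y - u x - v y)) \<partial>N) = 1) \<longrightarrow>
       integrable M f \<longrightarrow> (\<integral>x. f x \<partial>M) = 0 \<longrightarrow>
       (\<integral>\<^sup>+y. ennreal (1 + \<beta> * \<psi> y) * ennreal \<bar>\<integral>x. f x * exp (- W x y - u x - v y) \<partial>M\<bar> \<partial>N)
        \<le> ennreal \<rho> * (\<integral>\<^sup>+x. ennreal (1 + \<beta> * \<phi> x) * ennreal \<bar>f x\<bar> \<partial>M))"

context weighted_cost
begin

abbreviation "pot \<equiv> iterated_potential M N W"
abbreviation "dual \<equiv> dual_potential M N W"

text \<open>The bounds on the two integrals are what keeps the lower bounds from deteriorating with \<open>n\<close>:
  by monotonicity they need only be known at the start, where \<open>u\<^sub>0 = 0\<close> and \<open>v\<^sub>0 \<le> ln C\<close>.\<close>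

lemma potential_invariant:
  "pot n \<in> borel_measurable M \<and> integrable M (pot n) \<and> (\<integral>x. pot n x \<partial>M) \<le> 0 \<and>
   (AE x in M. - (\<integral>y. W x y \<partial>N) - ln C \<le> pot n x) \<and>
   integrable N (dual n) \<and> (\<integral>y. dual n y \<partial>N) \<le> ln C"
proof (induction n)
  case 0
  have lower: "AE x in M. - (\<integral>y. W x y \<partial>N) - ln C \<le> pot 0 x"
    using mean_cost_ge by eventually_elim simp
  note h = half_step[OF _ _ lower, folded dual_potential_def]
  have "integrable N (dual 0)" by (rule h(2)) simp_all
  moreover have "AE y in N. dual 0 y \<le> ln C"
    using h(5) by (simp add: M.prob_space)
  ultimately have "(\<integral>y. dual 0 y \<partial>N) \<le> (\<integral>y. ln C \<partial>N)"
    by (intro integral_mono_AE) auto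
  then show ?case using lower \<open>integrable N (dual 0)\<close> by (simp add: N.prob_space)
next
  case (Suc n)
  interpret S: weighted_cost N M "\<lambda>y x. W x y" C \<psi> \<phi> by (rule swapped_weighted)
  from Suc have IH: "pot n \<in> borel_measurable M" "integrable M (pot n)" "(\<integral>x. pot n x \<partial>M) \<le> 0"
    "AE x in M. - (\<integral>y. W x y \<partial>N) - ln C \<le> pot n x" "integrable N (dual n)" "(\<integral>y. dual n y \<partial>N) \<le> ln C"
    by auto
  note h = half_step[OF IH(1,2,4), folded dual_potential_def]
  have dm: "dual n \<in> borel_measurable N" using h(1) by (simp add: proper_transform_def)
  have "AE y in N. - (\<integral>x. W x y \<partial>M) - 0 \<le> dual n y"
    using h(3) by eventually_elim (use IH(3) in linarith)
  note h' = S.half_step[OF dm IH(5) this]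
  have eq: "log_integral_transform N (\<lambda>y x. W x y) (dual n) = pot (Suc n)"
    by (simp add: dual_potential_def)
  note h' = h'[unfolded eq]
  have pm: "pot (Suc n) \<in> borel_measurable M" using h'(1) by (simp add: proper_transform_def)
  have dec: "(\<integral>x. pot (Suc n) x \<partial>M) \<le> (\<integral>x. pot n x \<partial>M)"
    by (rule round_trip_decreases_integral[OF h(1) h'(1) IH(2) h'(2)])
  have lower: "AE x in M. - (\<integral>y. W x y \<partial>N) - ln C \<le> pot (Suc n) x"
    using h'(3) by eventually_elim (use IH(6) in linarith)
  note h'' = half_step[OF pm h'(2) lower, folded dual_potential_def]
  have "(\<integral>y. dual (Suc n) y \<partial>N) \<le> (\<integral>y. dual n y \<partial>N)"
    by (rule S.round_trip_decreases_integral[OF h'(1) _ IH(5) h''(2)]) (use h''(1) in simp)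
  then show ?case using pm h'(2) dec lower h''(2) IH by linarith
qed

lemma proper_dual: "proper_transform M N W (pot n) (dual n)"
  using half_step(1)[of "pot n" "ln C"] potential_invariant[of n] by (simp add: dual_potential_def)

lemma dual_lower: "AE y in N. - (\<integral>x. W x y \<partial>M) \<le> dual n y"
proof -
  have "AE y in N. - (\<integral>x. W x y \<partial>M) - (\<integral>x. pot n x \<partial>M) \<le> dual n y"
    unfolding dual_potential_def
    by (rule half_step(3)[where K = "ln C"]) (use potential_invariant[of n] in simp_all)
  then show ?thesis by eventually_elim (use potential_invariant[of n] in linarith)
qed

lemma proper_potential: "proper_transform N M (\<lambda>y x. W x y) (dual n) (pot (Suc n))"
proof -
  interpret S: weighted_cost N M "\<lambda>y x. W x y" C \<psi> \<phi> by (rule swapped_weighted)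
  have "proper_transform N M (\<lambda>y x. W x y) (dual n) (log_integral_transform N (\<lambda>y x. W x y) (dual n))"
    by (rule S.half_step(1)[where K = 0])
      (use potential_invariant[of n] dual_lower[of n] proper_dual[of n] in \<open>simp_all add: proper_transform_def\<close>)
  then show ?thesis by (simp add: dual_potential_def)
qed

lemma tame_potentials:
  "\<exists>L. \<forall>n. tame_potential M N W (ln C) L (pot (Suc n)) \<and>
     tame_potential N M (\<lambda>y x. W x y) (ln C) L (dual n)"
proof -
  interpret S: weighted_cost N M "\<lambda>y x. W x y" C \<psi> \<phi> by (rule swapped_weighted)
  let ?L1 = "ln (C * (exp (ln C) * (\<integral>x. exp (\<integral>y. W x y \<partial>N) \<partial>M)))"
  let ?L2 = "ln (C * (exp 0 * (\<integral>y. exp (\<integral>x. W x y \<partial>M) \<partial>N)))"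
  have C0: "0 \<le> ln C" using C_ge_1 by simp
  have "tame_potential M N W (ln C) (max ?L1 ?L2) (pot (Suc n)) \<and>
     tame_potential N M (\<lambda>y x. W x y) (ln C) (max ?L1 ?L2) (dual n)" for n
  proof
    have "AE y in N. dual n y \<le> ?L1" unfolding dual_potential_def
      by (rule half_step(4)) (use potential_invariant[of n] in simp_all)
    then have 1: "AE y in N. dual n y \<le> max ?L1 ?L2" by eventually_elim simp
    have 2: "AE y in N. - (\<integral>x. W x y \<partial>M) - ln C \<le> dual n y"
      using dual_lower[of n] by eventually_elim (use C0 in linarith)
    show "tame_potential N M (\<lambda>y x. W x y) (ln C) (max ?L1 ?L2) (dual n)"
      unfolding tame_potential_def using 1 2 proper_dual[of n] by (simp only: proper_transform_def)
    have "AE x in M. log_integral_transform N (\<lambda>y x. W x y) (dual n) x \<le> ?L2"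
      by (rule S.half_step(4)[where K = 0])
        (use potential_invariant[of n] dual_lower[of n] proper_dual[of n] in \<open>simp_all add: proper_transform_def\<close>)
    then have "AE x in M. pot (Suc n) x \<le> max ?L1 ?L2"
      by eventually_elim (simp add: dual_potential_def)
    then show "tame_potential M N W (ln C) (max ?L1 ?L2) (pot (Suc n))"
      unfolding tame_potential_def using potential_invariant[of "Suc n"] by blast
  qed
  then show ?thesis by blast
qed

section \<open>Uniform contraction and decay of the deviations\<close>

text \<open>The kernel is at most \<open>C exp (2 K) exp (W\<^sup>V x) exp (W\<^sub>U y)\<close>.  The factor in \<open>y\<close> is integrable
  against \<open>\<psi>\<close>, and the factor in \<open>x\<close> is at most a small multiple of \<open>\<phi>\<close> plus a constant.\<close>

lemma tame_lyapunov:
  "\<exists>c. \<forall>u v. tame_potential M N W K L u \<longrightarrow> tame_potential N M (\<lambda>y x. W x y) K L v \<longrightarrow>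
     (AE x in M. (\<integral>\<^sup>+y. ennreal (exp (- W x y - u x - v y) * \<psi> y) \<partial>N) \<le> ennreal (\<phi> x / 4 + c))"
proof -
  define B where "B = (\<integral>y. exp (\<integral>x. W x y \<partial>M) * \<psi> y \<partial>N)"
  have \<psi>0: "0 \<le> \<psi> y" for y using \<psi>_ge_1[of y] by linarith
  have B0: "0 \<le> B" unfolding B_def using \<psi>0 by (intro integral_nonneg_AE) auto
  have nB: "(\<integral>\<^sup>+y. ennreal (exp (\<integral>x. W x y \<partial>M) * \<psi> y) \<partial>N) = ennreal B"
    unfolding B_def using \<psi>0 integrable_exp_right by (intro nn_integral_eq_integral) auto
  define \<epsilon> where "\<epsilon> = 1 / (4 * (C * exp (2 * K) * (B + 1)))"
  have den: "0 < C * exp (2 * K) * (B + 1)" using C_ge_1 B0 by simp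
  then have "0 < \<epsilon>" by (simp add: \<epsilon>_def)
  then obtain c where c: "exp (\<integral>y. W x y \<partial>N) \<le> \<epsilon> * \<phi> x + c" for x using exp_left_small by blast
  have "AE x in M. (\<integral>\<^sup>+y. ennreal (exp (- W x y - u x - v y) * \<psi> y) \<partial>N)
      \<le> ennreal (\<phi> x / 4 + C * exp (2 * K) * (B + 1) * c)"
    if u: "tame_potential M N W K L u" and v: "tame_potential N M (\<lambda>y x. W x y) K L v" for u v
  proof -
    have [measurable]: "v \<in> borel_measurable N" using v by (simp add: tame_potential_def)
    have lu: "AE x in M. - (\<integral>y. W x y \<partial>N) - K \<le> u x" using u by (simp add: tame_potential_def)
    have lv: "AE y in N. - (\<integral>x. W x y \<partial>M) - K \<le> v y" using v by (simp add: tame_potential_def)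
    show ?thesis using exp_W_le lu
    proof eventually_elim
      case (elim x)
      let ?a = "\<integral>y. W x y \<partial>N"
      have "(\<integral>\<^sup>+y. ennreal (exp (- W x y - u x - v y) * \<psi> y) \<partial>N)
          \<le> (\<integral>\<^sup>+y. ennreal (C * exp (2 * K) * exp ?a) * ennreal (exp (\<integral>x. W x y \<partial>M) * \<psi> y) \<partial>N)"
        using elim(1) lv
      proof (intro nn_integral_mono_AE, eventually_elim)
        case e: (elim y)
        have "exp (- W x y - u x - v y) = exp (- W x y) * exp (- u x) * exp (- v y)"
          by (simp flip: exp_add)
        also have "\<dots> \<le> C * exp (?a + K) * exp ((\<integral>x. W x y \<partial>M) + K)"
          using e elim(2) C_ge_1 by (intro mult_mono) auto
        also have "\<dots> = C * exp (2 * K) * exp ?a * exp (\<integral>x. W x y \<partial>M)"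
          unfolding mult_2 exp_add by (simp only: mult_ac)
        finally have "exp (- W x y - u x - v y) * \<psi> y
            \<le> C * exp (2 * K) * exp ?a * exp (\<integral>x. W x y \<partial>M) * \<psi> y"
          using \<psi>0 by (rule mult_right_mono)
        then show ?case using C_ge_1 \<psi>0[of y]
          by (subst ennreal_mult[symmetric]) (auto intro!: ennreal_leI simp: mult.assoc)
      qed
      also have "\<dots> = ennreal (C * exp (2 * K) * exp ?a) * ennreal B"
        by (subst nn_integral_cmult) (simp_all add: nB)
      also have "\<dots> = ennreal (C * exp (2 * K) * exp ?a * B)"
        using B0 by (simp add: ennreal_mult'')
      also have "\<dots> \<le> ennreal (\<phi> x / 4 + C * exp (2 * K) * (B + 1) * c)"
      proof (rule ennreal_leI)
        have "C * exp (2 * K) * exp ?a * B \<le> C * exp (2 * K) * exp ?a * (B + 1)"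
          using C_ge_1 B0 by (intro mult_left_mono) auto
        also have "\<dots> = C * exp (2 * K) * (B + 1) * exp ?a" by (simp add: mult_ac)
        also have "\<dots> \<le> C * exp (2 * K) * (B + 1) * (\<epsilon> * \<phi> x + c)"
          using c den by (intro mult_left_mono) auto
        also have "\<dots> = C * exp (2 * K) * (B + 1) * \<epsilon> * \<phi> x + C * exp (2 * K) * (B + 1) * c"
          by (simp add: distrib_left mult.assoc)
        also have "C * exp (2 * K) * (B + 1) * \<epsilon> = 1 / 4"
        proof -
          have "d * (1 / (4 * d)) = 1 / 4" if "0 < d" for d :: real using that by simp
          then show ?thesis unfolding \<epsilon>_def using den by blast
        qed
        finally show "C * exp (2 * K) * exp ?a * B \<le> \<phi> x / 4 + C * exp (2 * K) * (B + 1) * c" by simp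
      qed
      finally show ?case .
    qed
  qed
  then show ?thesis by blast
qed

text \<open>The minorizing density is uniform on a sublevel set of \<open>\<psi>\<close> of positive measure.  It is chosen
  before \<open>R\<close>, so that the bound \<open>r\<close> on its \<open>\<psi>\<close>-moment does not depend on \<open>R\<close>.\<close>

lemma tame_minorization:
  "\<exists>g r. 0 \<le> r \<and> g \<in> borel_measurable N \<and> (\<forall>y. 0 \<le> g y) \<and> (\<integral>\<^sup>+y. ennreal (g y) \<partial>N) = 1 \<and>
     (\<integral>\<^sup>+y. ennreal (g y * \<psi> y) \<partial>N) \<le> ennreal r \<and>
     (\<forall>R. \<exists>\<alpha>>0. \<forall>u v. tame_potential M N W K L u \<longrightarrow> tame_potential N M (\<lambda>y x. W x y) K L v \<longrightarrow>
       (AE x in M. \<phi> x \<le> R \<longrightarrow> (AE y in N. \<alpha> * g y \<le> exp (- W x y - u x - v y))))"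
proof -
  have "\<exists>n. measure N {y \<in> space N. \<psi> y \<le> real n} \<noteq> 0"
  proof (rule ccontr)
    assume "\<not> ?thesis"
    then have "{y \<in> space N. \<psi> y \<le> real n} \<in> null_sets N" for n
      by (auto simp: null_sets_def N.emeasure_eq_measure)
    from AE_not_in[OF this] have "AE y in N. \<not> \<psi> y \<le> real n" for n
      using AE_space by eventually_elim auto
    then have "AE y in N. \<forall>n. \<not> \<psi> y \<le> real n" by (simp add: AE_all_countable)
    then have "AE y in N. False"
      by eventually_elim (use real_arch_simple in blast)
    then show False by (simp add: N.AE_False)
  qed
  then obtain n where n: "measure N {y \<in> space N. \<psi> y \<le> real n} \<noteq> 0" by blast
  define r where "r = real n"
  define B where "B = {y \<in> space N. \<psi> y \<le> r}"
  have [measurable]: "B \<in> sets N" unfolding B_def by measurable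
  define p where "p = measure N B"
  have p0: "0 < p" using n by (simp add: p_def B_def r_def zero_less_measure_iff)
  have nB: "emeasure N B = ennreal p" by (simp add: p_def N.emeasure_eq_measure)
  define g where "g y = indicator B y / p" for y
  have [measurable]: "g \<in> borel_measurable N" unfolding g_def by measurable
  have g0: "0 \<le> g y" for y using p0 by (simp add: g_def)
  have geq: "ennreal (g y) = ennreal (1 / p) * indicator B y" for y
    by (cases "y \<in> B") (simp_all add: g_def)
  have "(\<integral>\<^sup>+y. ennreal (g y) \<partial>N) = ennreal (1 / p) * emeasure N B"
    unfolding geq by (rule nn_integral_cmult_indicator) simp
  also have "\<dots> = ennreal (1 / p * p)"
    unfolding nB using p0 by (intro ennreal_mult[symmetric]) auto
  finally have g1: "(\<integral>\<^sup>+y. ennreal (g y) \<partial>N) = 1" using p0 by simp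
  have r0: "0 \<le> r" by (simp add: r_def)
  have "g y * \<psi> y \<le> r * g y" for y
    using p0 by (cases "y \<in> B") (simp_all add: g_def B_def divide_right_mono)
  then have "(\<integral>\<^sup>+y. ennreal (g y * \<psi> y) \<partial>N) \<le> (\<integral>\<^sup>+y. ennreal (r * g y) \<partial>N)"
    by (intro nn_integral_mono ennreal_leI)
  also have "\<dots> = (\<integral>\<^sup>+y. ennreal r * ennreal (g y) \<partial>N)"
    using r0 g0 by (intro nn_integral_cong ennreal_mult)
  also have "\<dots> = ennreal r * (\<integral>\<^sup>+y. ennreal (g y) \<partial>N)"
    by (rule nn_integral_cmult) measurable
  also have "\<dots> = ennreal r" by (simp add: g1)
  finally have gr: "(\<integral>\<^sup>+y. ennreal (g y * \<psi> y) \<partial>N) \<le> ennreal r" .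
  have "\<exists>\<alpha>>0. \<forall>u v. tame_potential M N W K L u \<longrightarrow> tame_potential N M (\<lambda>y x. W x y) K L v \<longrightarrow>
       (AE x in M. \<phi> x \<le> R \<longrightarrow> (AE y in N. \<alpha> * g y \<le> exp (- W x y - u x - v y)))" for R
  proof -
    obtain w where w: "\<phi> x \<le> max R r \<Longrightarrow> \<psi> y \<le> max R r \<Longrightarrow> W x y \<le> w" for x y
      using W_bounded[of "max R r"] by blast
    have "AE x in M. \<phi> x \<le> R \<longrightarrow> (AE y in N. (exp (- w - 2 * L) * p) * g y \<le> exp (- W x y - u x - v y))"
      if u: "tame_potential M N W K L u" and v: "tame_potential N M (\<lambda>y x. W x y) K L v" for u v
    proof -
      have lu: "AE x in M. u x \<le> L" and lv: "AE y in N. v y \<le> L"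
        using u v by (simp_all add: tame_potential_def)
      show ?thesis using lu
      proof (eventually_elim, intro impI)
        fix x assume x: "u x \<le> L" "\<phi> x \<le> R"
        show "AE y in N. (exp (- w - 2 * L) * p) * g y \<le> exp (- W x y - u x - v y)"
          using lv
        proof eventually_elim
          case (elim y)
          show ?case
          proof (cases "y \<in> B")
            case True
            then have "W x y \<le> w" using x by (intro w) (auto simp: B_def)
            then show ?thesis using True p0 x elim by (simp add: g_def)
          qed (simp add: g_def)
        qed
      qed
    qed
    moreover have "0 < exp (- w - 2 * L) * p" using p0 by simp
    ultimately show ?thesis by blast
  qed
  note minor = this
  show ?thesis
    by (intro exI[of _ g] exI[of _ r] conjI allI r0 g0 g1 gr minor) measurable
qed

text \<open>Stated for all sufficiently large \<open>c\<close> and all sufficiently small \<open>\<alpha>\<close>, so that the two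
  directions of the iteration can be given the same weight and the same rate.\<close>

lemma tame_contraction:
  "\<exists>c\<^sub>0>0. \<forall>c\<ge>c\<^sub>0. \<exists>\<alpha>\<^sub>0>0. \<forall>\<alpha>. 0 < \<alpha> \<longrightarrow> \<alpha> \<le> \<alpha>\<^sub>0 \<longrightarrow> \<alpha> \<le> 1 \<longrightarrow>
     contracts_deviations M N W \<phi> \<psi> K L (\<alpha> / (2 * c)) (1 - \<alpha> / 4)"
proof -
  obtain c1 where c1: "\<And>u v. tame_potential M N W K L u \<Longrightarrow> tame_potential N M (\<lambda>y x. W x y) K L v \<Longrightarrow>
     AE x in M. (\<integral>\<^sup>+y. ennreal (exp (- W x y - u x - v y) * \<psi> y) \<partial>N) \<le> ennreal (\<phi> x / 4 + c1)"
    using tame_lyapunov[of K L] by blast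
  obtain g r0 where r0: "0 \<le> r0" and [measurable]: "g \<in> borel_measurable N"
    and g: "\<And>y. 0 \<le> g y" "(\<integral>\<^sup>+y. ennreal (g y) \<partial>N) = 1" "(\<integral>\<^sup>+y. ennreal (g y * \<psi> y) \<partial>N) \<le> ennreal r0"
    and m: "\<And>R. \<exists>\<alpha>>0. \<forall>u v. tame_potential M N W K L u \<longrightarrow> tame_potential N M (\<lambda>y x. W x y) K L v \<longrightarrow>
       (AE x in M. \<phi> x \<le> R \<longrightarrow> (AE y in N. \<alpha> * g y \<le> exp (- W x y - u x - v y)))"
    using tame_minorization[of K L] by blast
  have step: "\<exists>\<alpha>\<^sub>0>0. \<forall>\<alpha>. 0 < \<alpha> \<longrightarrow> \<alpha> \<le> \<alpha>\<^sub>0 \<longrightarrow> \<alpha> \<le> 1 \<longrightarrow>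
     contracts_deviations M N W \<phi> \<psi> K L (\<alpha> / (2 * c)) (1 - \<alpha> / 4)"
    if c: "max 1 c1 \<le> c" for c
  proof -
    let ?R = "7 * c + 2 * r0"
    obtain \<alpha>\<^sub>0 where a0: "0 < \<alpha>\<^sub>0"
      and a: "\<And>u v. tame_potential M N W K L u \<Longrightarrow> tame_potential N M (\<lambda>y x. W x y) K L v \<Longrightarrow>
       AE x in M. \<phi> x \<le> ?R \<longrightarrow> (AE y in N. \<alpha>\<^sub>0 * g y \<le> exp (- W x y - u x - v y))"
      using m[of ?R] by blast
    have bound: "(\<integral>\<^sup>+y. ennreal (1 + \<alpha> / (2 * c) * \<psi> y) * ennreal \<bar>\<integral>x. f x * exp (- W x y - u x - v y) \<partial>M\<bar> \<partial>N)
        \<le> ennreal (1 - \<alpha> / 4) * (\<integral>\<^sup>+x. ennreal (1 + \<alpha> / (2 * c) * \<phi> x) * ennreal \<bar>f x\<bar> \<partial>M)"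
      if al: "0 < \<alpha>" "\<alpha> \<le> \<alpha>\<^sub>0" "\<alpha> \<le> 1"
        and u: "tame_potential M N W K L u" and v: "tame_potential N M (\<lambda>y x. W x y) K L v"
        and mass: "AE x in M. (\<integral>\<^sup>+y. ennreal (exp (- W x y - u x - v y)) \<partial>N) = 1"
        and f: "integrable M f" "(\<integral>x. f x \<partial>M) = 0" for \<alpha> u v f
    proof (rule centred_kernel_contraction[where g = g and r = r0 and R = ?R])
      have [measurable]: "u \<in> borel_measurable M" "v \<in> borel_measurable N"
        using u v by (simp_all add: tame_potential_def)
      show "(\<lambda>(x, y). exp (- W x y - u x - v y)) \<in> borel_measurable (M \<Otimes>\<^sub>M N)" by measurable
      show "AE x in M. (\<integral>\<^sup>+y. ennreal (exp (- W x y - u x - v y) * \<psi> y) \<partial>N) \<le> ennreal (\<phi> x / 4 + c)"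
        using c1[OF u v]
      proof eventually_elim
        case (elim x)
        have "ennreal (\<phi> x / 4 + c1) \<le> ennreal (\<phi> x / 4 + c)" using c by (intro ennreal_leI) auto
        with elim show ?case by (rule order_trans)
      qed
      show "AE x in M. \<phi> x \<le> ?R \<longrightarrow> (AE y in N. \<alpha> * g y \<le> exp (- W x y - u x - v y))"
        using a[OF u v]
      proof (eventually_elim, intro impI)
        fix x assume "\<phi> x \<le> ?R \<longrightarrow> (AE y in N. \<alpha>\<^sub>0 * g y \<le> exp (- W x y - u x - v y))" and "\<phi> x \<le> ?R"
        then have "AE y in N. \<alpha>\<^sub>0 * g y \<le> exp (- W x y - u x - v y)" by simp
        then show "AE y in N. \<alpha> * g y \<le> exp (- W x y - u x - v y)"
        proof eventually_elim
          case (elim y)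
          have "\<alpha> * g y \<le> \<alpha>\<^sub>0 * g y" using al g(1) by (intro mult_right_mono) auto
          with elim show ?case by linarith
        qed
      qed
      show "0 \<le> \<phi> x" for x using \<phi>_ge_1[of x] by linarith
      show "0 \<le> \<psi> y" for y using \<psi>_ge_1[of y] by linarith
      show "AE x in M. (\<integral>\<^sup>+y. ennreal (exp (- W x y - u x - v y)) \<partial>N) = 1" by (rule mass)
      show "integrable M f" "(\<integral>x. f x \<partial>M) = 0" by (rule f)+
      show "(\<integral>\<^sup>+y. ennreal (g y) \<partial>N) = 1" "(\<integral>\<^sup>+y. ennreal (g y * \<psi> y) \<partial>N) \<le> ennreal r0"
        by (rule g)+
      show "0 \<le> g y" for y by (rule g)
      show "0 < \<alpha>" "\<alpha> \<le> 1" "0 \<le> r0" by (rule al r0)+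
      show "0 < c" using c by linarith
    qed (simp_all add: prob_M prob_N)
    show ?thesis
    proof (intro exI[of _ \<alpha>\<^sub>0] conjI allI impI a0)
      fix \<alpha> assume "0 < \<alpha>" "\<alpha> \<le> \<alpha>\<^sub>0" "\<alpha> \<le> (1::real)"
      then show "contracts_deviations M N W \<phi> \<psi> K L (\<alpha> / (2 * c)) (1 - \<alpha> / 4)"
        unfolding contracts_deviations_def by (intro allI impI) (rule bound)
    qed
  qed
  show ?thesis
    by (intro exI[of _ "max 1 c1"] conjI allI impI step) simp_all
qed

lemma deviation_integrable_centred:
  assumes uv: "proper_transform M N W u v" and vu: "proper_transform N M (\<lambda>y x. W x y) v u'"
  shows "integrable M (\<lambda>x. exp (u' x - u x) - 1)" "(\<integral>x. exp (u' x - u x) - 1 \<partial>M) = 0"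
proof -
  have [measurable]: "u \<in> borel_measurable M" "u' \<in> borel_measurable M"
    using uv vu by (simp_all add: proper_transform_def)
  have ie: "integrable M (\<lambda>x. exp (u' x - u x))"
    using round_trip_mass[OF uv vu] by (intro integrableI_nonneg) auto
  have "(\<integral>x. exp (u' x - u x) \<partial>M) = 1"
    using round_trip_mass[OF uv vu] by (subst integral_eq_nn_integral) auto
  then show "integrable M (\<lambda>x. exp (u' x - u x) - 1)" "(\<integral>x. exp (u' x - u x) - 1 \<partial>M) = 0"
    using ie by (simp_all add: M.prob_space)
qed

lemma deviation_step:
  assumes uv: "proper_transform M N W u v" and vu: "proper_transform N M (\<lambda>y x. W x y) v u'"
    and uv': "proper_transform M N W u' v'"
    and step: "(\<integral>\<^sup>+y. ennreal (1 + \<beta> * \<psi> y) *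
          ennreal \<bar>\<integral>x. (exp (u' x - u x) - 1) * exp (- W x y - u' x - v y) \<partial>M\<bar> \<partial>N)
        \<le> ennreal \<rho> * (\<integral>\<^sup>+x. ennreal (1 + \<beta> * \<phi> x) * ennreal \<bar>exp (u' x - u x) - 1\<bar> \<partial>M)"
  shows "(\<integral>\<^sup>+y. ennreal (1 + \<beta> * \<psi> y) * ennreal \<bar>exp (v' y - v y) - 1\<bar> \<partial>N)
        \<le> ennreal \<rho> * (\<integral>\<^sup>+x. ennreal (1 + \<beta> * \<phi> x) * ennreal \<bar>exp (u' x - u x) - 1\<bar> \<partial>M)"
proof -
  have "(\<integral>\<^sup>+y. ennreal (1 + \<beta> * \<psi> y) * ennreal \<bar>exp (v' y - v y) - 1\<bar> \<partial>N)
      = (\<integral>\<^sup>+y. ennreal (1 + \<beta> * \<psi> y) *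
          ennreal \<bar>\<integral>x. (exp (u' x - u x) - 1) * exp (- W x y - u' x - v y) \<partial>M\<bar> \<partial>N)"
    using kernel_maps_deviation[OF uv vu uv']
    by (intro nn_integral_cong_AE, eventually_elim) (simp add: abs_minus_commute)
  with step show ?thesis by simp
qed

text \<open>Each deviation is the image of the previous one, alternately on the two spaces.  Two half-steps
  return to the same space and contract its weighted norm by the square of the common rate.
  The weights \<open>\<psi>\<close> and \<open>1 + \<beta> \<psi>\<close> are comparable since \<open>\<psi> \<ge> 1\<close>.\<close>

theorem deviation_decay:
  "\<exists>\<rho> c. 0 \<le> \<rho> \<and> \<rho> < 1 \<and> 0 \<le> c \<and> (\<forall>n.
     (\<integral>\<^sup>+y. ennreal (\<psi> y) * ennreal \<bar>exp (dual (Suc n) y - dual n y) - 1\<bar> \<partial>N)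
       \<le> ennreal (c * \<rho> ^ n) * (\<integral>\<^sup>+y. ennreal (\<psi> y) * ennreal \<bar>exp (dual 1 y - dual 0 y) - 1\<bar> \<partial>N) \<and>
     (\<integral>\<^sup>+x. ennreal (\<phi> x) * ennreal \<bar>exp (pot (Suc (Suc n)) x - pot (Suc n) x) - 1\<bar> \<partial>M)
       \<le> ennreal (c * \<rho> ^ n) * (\<integral>\<^sup>+x. ennreal (\<phi> x) * ennreal \<bar>exp (pot 2 x - pot 1 x) - 1\<bar> \<partial>M))"
proof -
  interpret S: weighted_cost N M "\<lambda>y x. W x y" C \<psi> \<phi> by (rule swapped_weighted)
  obtain L where L: "\<And>n. tame_potential M N W (ln C) L (pot (Suc n))"
    "\<And>n. tame_potential N M (\<lambda>y x. W x y) (ln C) L (dual n)"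
    using tame_potentials by blast
  obtain c1 where c1: "0 < c1" and con1: "\<forall>c\<ge>c1.
     \<exists>\<alpha>\<^sub>0>0. \<forall>\<alpha>. 0 < \<alpha> \<longrightarrow> \<alpha> \<le> \<alpha>\<^sub>0 \<longrightarrow> \<alpha> \<le> 1 \<longrightarrow>
       contracts_deviations M N W \<phi> \<psi> (ln C) L (\<alpha> / (2 * c)) (1 - \<alpha> / 4)"
    using tame_contraction[of "ln C" L] by (elim exE conjE)
  obtain c2 where c2: "0 < c2" and con2: "\<forall>c\<ge>c2.
     \<exists>\<alpha>\<^sub>0>0. \<forall>\<alpha>. 0 < \<alpha> \<longrightarrow> \<alpha> \<le> \<alpha>\<^sub>0 \<longrightarrow> \<alpha> \<le> 1 \<longrightarrow>
       contracts_deviations N M (\<lambda>y x. W x y) \<psi> \<phi> (ln C) L (\<alpha> / (2 * c)) (1 - \<alpha> / 4)"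
    using S.tame_contraction[of "ln C" L] by (elim exE conjE)
  define c where "c = max c1 c2"
  have cc: "c1 \<le> c" "c2 \<le> c" "0 < c" using c1 by (auto simp: c_def)
  obtain \<alpha>1 where a1: "0 < \<alpha>1" and K1: "\<forall>\<alpha>. 0 < \<alpha> \<longrightarrow> \<alpha> \<le> \<alpha>1 \<longrightarrow> \<alpha> \<le> 1 \<longrightarrow>
     contracts_deviations M N W \<phi> \<psi> (ln C) L (\<alpha> / (2 * c)) (1 - \<alpha> / 4)"
    using con1[rule_format, OF cc(1)] by (elim exE conjE)
  obtain \<alpha>2 where a2: "0 < \<alpha>2" and K2: "\<forall>\<alpha>. 0 < \<alpha> \<longrightarrow> \<alpha> \<le> \<alpha>2 \<longrightarrow> \<alpha> \<le> 1 \<longrightarrow>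
     contracts_deviations N M (\<lambda>y x. W x y) \<psi> \<phi> (ln C) L (\<alpha> / (2 * c)) (1 - \<alpha> / 4)"
    using con2[rule_format, OF cc(2)] by (elim exE conjE)
  define \<alpha> where "\<alpha> = min 1 (min \<alpha>1 \<alpha>2)"
  have al: "0 < \<alpha>" "\<alpha> \<le> 1" "\<alpha> \<le> \<alpha>1" "\<alpha> \<le> \<alpha>2" using a1 a2 by (auto simp: \<alpha>_def)
  define \<beta> \<rho> where "\<beta> = \<alpha> / (2 * c)" and "\<rho> = 1 - \<alpha> / 4"
  have b0: "0 < \<beta>" and rho: "0 \<le> \<rho>" "\<rho> < 1" using al cc by (auto simp: \<beta>_def \<rho>_def)
  define E where "E n = (\<integral>\<^sup>+y. ennreal (1 + \<beta> * \<psi> y) * ennreal \<bar>exp (dual (Suc n) y - dual n y) - 1\<bar> \<partial>N)" for n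
  define D where "D n = (\<integral>\<^sup>+x. ennreal (1 + \<beta> * \<phi> x) * ennreal \<bar>exp (pot (Suc n) x - pot n x) - 1\<bar> \<partial>M)" for n
  have ED: "E n \<le> ennreal \<rho> * D n" for n
    unfolding E_def D_def
  proof (rule deviation_step[OF proper_dual proper_potential proper_dual])
    show "(\<integral>\<^sup>+y. ennreal (1 + \<beta> * \<psi> y) *
          ennreal \<bar>\<integral>x. (exp (pot (Suc n) x - pot n x) - 1) * exp (- W x y - pot (Suc n) x - dual n y) \<partial>M\<bar> \<partial>N)
        \<le> ennreal \<rho> * (\<integral>\<^sup>+x. ennreal (1 + \<beta> * \<phi> x) * ennreal \<bar>exp (pot (Suc n) x - pot n x) - 1\<bar> \<partial>M)"
      unfolding \<beta>_def \<rho>_def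
      by (rule K1[rule_format, OF al(1,3,2), unfolded contracts_deviations_def, rule_format,
            OF L kernel_mass[OF proper_potential] deviation_integrable_centred[OF proper_dual proper_potential]])
  qed
  have DE: "D (Suc n) \<le> ennreal \<rho> * E n" for n
    unfolding E_def D_def
  proof (rule S.deviation_step[OF proper_potential _ proper_potential])
    show "proper_transform M N W (pot (Suc n)) (dual (Suc n))" by (rule proper_dual)
    show "(\<integral>\<^sup>+x. ennreal (1 + \<beta> * \<phi> x) *
          ennreal \<bar>\<integral>y. (exp (dual (Suc n) y - dual n y) - 1) * exp (- W x y - dual (Suc n) y - pot (Suc n) x) \<partial>N\<bar> \<partial>M)
        \<le> ennreal \<rho> * (\<integral>\<^sup>+y. ennreal (1 + \<beta> * \<psi> y) * ennreal \<bar>exp (dual (Suc n) y - dual n y) - 1\<bar> \<partial>N)"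
      unfolding \<beta>_def \<rho>_def
      by (rule K2[rule_format, OF al(1,4,2), unfolded contracts_deviations_def, rule_format,
            OF L(2,1) S.kernel_mass[OF proper_dual] S.deviation_integrable_centred[OF proper_potential proper_dual]])
  qed
  have E_geo: "E n \<le> ennreal ((\<rho> * \<rho>) ^ n) * E 0" for n
  proof (induction n)
    case (Suc n)
    have "E (Suc n) \<le> ennreal \<rho> * (ennreal \<rho> * E n)"
      using ED[of "Suc n"] DE[of n] by (meson mult_left_mono order_trans zero_le)
    also have "\<dots> \<le> ennreal \<rho> * (ennreal \<rho> * (ennreal ((\<rho> * \<rho>) ^ n) * E 0))"
      using Suc by (intro mult_left_mono) auto
    finally show ?case using rho by (simp add: ennreal_mult mult_ac)
  qed simp
  have D_geo: "D (Suc n) \<le> ennreal ((\<rho> * \<rho>) ^ n) * D 1" for n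
  proof (induction n)
    case (Suc n)
    have "D (Suc (Suc n)) \<le> ennreal \<rho> * (ennreal \<rho> * D (Suc n))"
      using DE[of "Suc n"] ED[of "Suc n"] by (meson mult_left_mono order_trans zero_le)
    also have "\<dots> \<le> ennreal \<rho> * (ennreal \<rho> * (ennreal ((\<rho> * \<rho>) ^ n) * D 1))"
      using Suc by (intro mult_left_mono) auto
    finally show ?case using rho by (simp add: ennreal_mult mult_ac)
  qed simp
  have weight: "ennreal t * z \<le> ennreal (1 / \<beta>) * (ennreal (1 + \<beta> * t) * z)"
    "ennreal (1 + \<beta> * t) * z \<le> ennreal (1 + \<beta>) * (ennreal t * z)" if "1 \<le> t" for t z
  proof -
    have "t \<le> 1 / \<beta> * (1 + \<beta> * t)" using b0 by (simp add: field_simps)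
    moreover have "ennreal (1 / \<beta> * (1 + \<beta> * t)) = ennreal (1 / \<beta>) * ennreal (1 + \<beta> * t)"
      by (rule ennreal_mult') (use b0 in simp)
    ultimately have "ennreal t \<le> ennreal (1 / \<beta>) * ennreal (1 + \<beta> * t)"
      by (metis ennreal_leI)
    then show "ennreal t * z \<le> ennreal (1 / \<beta>) * (ennreal (1 + \<beta> * t) * z)"
      by (metis mult.assoc mult_right_mono zero_le)
    have "1 + \<beta> * t \<le> (1 + \<beta>) * t" using that by (simp add: algebra_simps)
    moreover have "ennreal ((1 + \<beta>) * t) = ennreal (1 + \<beta>) * ennreal t"
      by (rule ennreal_mult') (use b0 in simp)
    ultimately have "ennreal (1 + \<beta> * t) \<le> ennreal (1 + \<beta>) * ennreal t"
      by (metis ennreal_leI)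
    then show "ennreal (1 + \<beta> * t) * z \<le> ennreal (1 + \<beta>) * (ennreal t * z)"
      by (metis mult.assoc mult_right_mono zero_le)
  qed
  have [measurable]: "pot n \<in> borel_measurable M" "dual n \<in> borel_measurable N" for n
    using proper_dual[of n] by (simp_all add: proper_transform_def)
  have combine: "A \<le> ennreal (1 / \<beta>) * X \<Longrightarrow> X \<le> ennreal ((\<rho> * \<rho>) ^ n) * Y \<Longrightarrow>
      Y \<le> ennreal (1 + \<beta>) * Z \<Longrightarrow> A \<le> ennreal ((1 / \<beta> * (1 + \<beta>)) * (\<rho> * \<rho>) ^ n) * Z" for A X Y Z n
  proof -
    assume 1: "A \<le> ennreal (1 / \<beta>) * X" and 2: "X \<le> ennreal ((\<rho> * \<rho>) ^ n) * Y" and 3: "Y \<le> ennreal (1 + \<beta>) * Z"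
    have "A \<le> ennreal (1 / \<beta>) * (ennreal ((\<rho> * \<rho>) ^ n) * (ennreal (1 + \<beta>) * Z))"
      using 1 2 3 by (meson mult_left_mono order_trans zero_le)
    also have "\<dots> = (ennreal (1 / \<beta>) * ennreal (1 + \<beta>)) * ennreal ((\<rho> * \<rho>) ^ n) * Z"
      by (simp only: mult_ac)
    also have "ennreal (1 / \<beta>) * ennreal (1 + \<beta>) = ennreal (1 / \<beta> * (1 + \<beta>))"
      by (rule ennreal_mult'[symmetric]) (use b0 in simp)
    also have "\<dots> * ennreal ((\<rho> * \<rho>) ^ n) = ennreal (1 / \<beta> * (1 + \<beta>) * (\<rho> * \<rho>) ^ n)"
      by (rule ennreal_mult''[symmetric]) (use rho in simp)
    finally show ?thesis .
  qed
  have dec_\<psi>: "(\<integral>\<^sup>+y. ennreal (\<psi> y) * ennreal \<bar>exp (dual (Suc n) y - dual n y) - 1\<bar> \<partial>N)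
      \<le> ennreal ((1 / \<beta> * (1 + \<beta>)) * (\<rho> * \<rho>) ^ n) *
        (\<integral>\<^sup>+y. ennreal (\<psi> y) * ennreal \<bar>exp (dual 1 y - dual 0 y) - 1\<bar> \<partial>N)" for n
  proof (rule combine[OF _ E_geo])
    show "(\<integral>\<^sup>+y. ennreal (\<psi> y) * ennreal \<bar>exp (dual (Suc n) y - dual n y) - 1\<bar> \<partial>N) \<le> ennreal (1 / \<beta>) * E n"
      unfolding E_def One_nat_def by (subst nn_integral_cmult[symmetric]) (measurable, intro nn_integral_mono weight \<psi>_ge_1)
    show "E 0 \<le> ennreal (1 + \<beta>) * (\<integral>\<^sup>+y. ennreal (\<psi> y) * ennreal \<bar>exp (dual 1 y - dual 0 y) - 1\<bar> \<partial>N)"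
      unfolding E_def One_nat_def by (subst nn_integral_cmult[symmetric]) (measurable, intro nn_integral_mono weight \<psi>_ge_1)
  qed
  have dec_\<phi>: "(\<integral>\<^sup>+x. ennreal (\<phi> x) * ennreal \<bar>exp (pot (Suc (Suc n)) x - pot (Suc n) x) - 1\<bar> \<partial>M)
      \<le> ennreal ((1 / \<beta> * (1 + \<beta>)) * (\<rho> * \<rho>) ^ n) *
        (\<integral>\<^sup>+x. ennreal (\<phi> x) * ennreal \<bar>exp (pot 2 x - pot 1 x) - 1\<bar> \<partial>M)" for n
  proof (rule combine[OF _ D_geo])
    show "(\<integral>\<^sup>+x. ennreal (\<phi> x) * ennreal \<bar>exp (pot (Suc (Suc n)) x - pot (Suc n) x) - 1\<bar> \<partial>M)
        \<le> ennreal (1 / \<beta>) * D (Suc n)"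
      unfolding D_def by (subst nn_integral_cmult[symmetric]) (measurable, intro nn_integral_mono weight \<phi>_ge_1)
    show "D 1 \<le> ennreal (1 + \<beta>) * (\<integral>\<^sup>+x. ennreal (\<phi> x) * ennreal \<bar>exp (pot 2 x - pot 1 x) - 1\<bar> \<partial>M)"
      unfolding D_def numeral_2_eq_2 One_nat_def
      by (subst nn_integral_cmult[symmetric]) (measurable, intro nn_integral_mono weight \<phi>_ge_1)
  qed
  have "\<rho> * \<rho> < 1"
    using mult_left_le[of \<rho> \<rho>] rho by linarith
  then show ?thesis
    by (intro exI[of _ "\<rho> * \<rho>"] exI[of _ "1 / \<beta> * (1 + \<beta>)"] conjI allI dec_\<psi> dec_\<phi>)
      (use rho b0 in simp_all)
qed

end

lemma (in weighted_cost) ratio_measurable: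
  "(\<lambda>x. exp (pot m x - pot n x)) \<in> borel_measurable M"
  "(\<lambda>y. exp (dual m y - dual n y)) \<in> borel_measurable N"
proof -
  have [measurable]: "pot n \<in> borel_measurable M" "dual n \<in> borel_measurable N" for n
    using proper_dual[of n] by (simp_all add: proper_transform_def)
  show "(\<lambda>x. exp (pot m x - pot n x)) \<in> borel_measurable M"
    "(\<lambda>y. exp (dual m y - dual n y)) \<in> borel_measurable N"
    by measurable
qed

section \<open>Gibbs measures and condition \<open>\<H>\<^sub>\<delta>\<close>\<close>

lemma gibbs_density:
  assumes [measurable]: "F \<in> borel_measurable lam" "h \<in> borel_measurable lam" and h0: "\<And>x. 0 \<le> h x"
  shows "density lam (\<lambda>x. ennreal (h x)) = density (gibbs lam F) (\<lambda>x. ennreal (exp (F x) * h x))"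
proof -
  have "density (gibbs lam F) (\<lambda>x. ennreal (exp (F x) * h x))
      = density lam (\<lambda>x. ennreal (exp (- F x)) * ennreal (exp (F x) * h x))"
    unfolding gibbs_def by (rule density_density_eq) measurable
  also have "(\<lambda>x. ennreal (exp (- F x)) * ennreal (exp (F x) * h x)) = (\<lambda>x. ennreal (h x))"
    using h0 by (simp add: ennreal_mult[symmetric] mult.assoc[symmetric] exp_add[symmetric])
  finally show ?thesis ..
qed

lemma AE_gibbs:
  assumes "F \<in> borel_measurable lam" and "AE x in lam. P x"
  shows "AE x in gibbs lam F. P x"
  unfolding gibbs_def using assms by (subst AE_density) auto

text \<open>A measure with a finite, strictly positive density with respect to a probability measure is
  sigma-finite.\<close>

lemma sigma_finite_of_gibbs:
  assumes [measurable]: "F \<in> borel_measurable lam" and "prob_space (gibbs lam F)"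
  shows "sigma_finite_measure lam"
proof -
  interpret prob_space "gibbs lam F" by fact
  have "lam = density (gibbs lam F) (\<lambda>x. ennreal (exp (F x) * 1))"
    using gibbs_density[of F lam "\<lambda>_. 1"] by (simp add: density_1)
  moreover have "sigma_finite_measure (density (gibbs lam F) (\<lambda>x. ennreal (exp (F x) * 1)))"
    by (subst sigma_finite_iff_density_finite) (auto simp: gibbs_def)
  ultimately show ?thesis by simp
qed

text \<open>Passing from \<open>\<nu>\<close> to \<open>\<nu>\<^sub>V\<close> removes \<open>V\<close> from the potential.\<close>

lemma kernel_apply_gibbs:
  assumes [measurable]: "V \<in> borel_measurable nu" "v \<in> borel_measurable nu" "W x \<in> borel_measurable nu"
  shows "kernel_apply (kernel_Q nu W) (\<lambda>y. exp (- (V y + v y))) x = (\<integral>y. exp (- W x y - v y) \<partial>gibbs nu V)"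
proof -
  have "(\<integral>y. exp (- (V y + v y)) \<partial>kernel_Q nu W x) = (\<integral>y. exp (- W x y) * exp (- (V y + v y)) \<partial>nu)"
    unfolding kernel_Q_def by (subst integral_density) auto
  also have "\<dots> = (\<integral>y. exp (- V y) * exp (- W x y - v y) \<partial>nu)"
    by (simp flip: exp_add add: algebra_simps)
  also have "\<dots> = (\<integral>y. exp (- W x y - v y) \<partial>gibbs nu V)"
    unfolding gibbs_def by (subst integral_density) auto
  finally show ?thesis by (simp add: kernel_apply_def)
qed

lemma normalised_kernel_gibbs:
  assumes [measurable]: "V \<in> borel_measurable nu" "v \<in> borel_measurable nu" "W x \<in> borel_measurable nu"
    and Z: "0 \<le> Z"
  shows "density (kernel_Q nu W x) (\<lambda>y. ennreal (exp (- (V y + v y)) / Z))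
    = density (gibbs nu V) (\<lambda>y. ennreal (exp (- W x y - v y) / Z))"
proof -
  have "density (kernel_Q nu W x) (\<lambda>y. ennreal (exp (- (V y + v y)) / Z))
      = density nu (\<lambda>y. ennreal (exp (- W x y)) * ennreal (exp (- (V y + v y)) / Z))"
    unfolding kernel_Q_def by (rule density_density_eq) measurable
  also have "(\<lambda>y. ennreal (exp (- W x y)) * ennreal (exp (- (V y + v y)) / Z))
      = (\<lambda>y. ennreal (exp (- W x y) * (exp (- (V y + v y)) / Z)))"
    using Z by (intro ext ennreal_mult[symmetric]) auto
  also have "density nu \<dots> = density (gibbs nu V)
      (\<lambda>y. ennreal (exp (V y) * (exp (- W x y) * (exp (- (V y + v y)) / Z))))"
    using Z by (intro gibbs_density) auto
  also have "(\<lambda>y. exp (V y) * (exp (- W x y) * (exp (- (V y + v y)) / Z))) = (\<lambda>y. exp (- W x y - v y) / Z)"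
    by (rule ext) (simp add: exp_diff exp_minus exp_add field_simps)
  finally show ?thesis by (simp add: fun_eq_iff)
qed

lemma kernel_R_eq_kernel_Q: "kernel_R lam W = kernel_Q lam (\<lambda>y x. W x y)"
  by (rule ext) (simp add: kernel_R_def kernel_Q_def)

lemma bdd_below_of_compact_sublevels:
  fixes f :: "'a::topological_space \<Rightarrow> real"
  assumes "locally_bounded f" "compact_sublevels f"
  shows "bdd_below (range f)"
proof -
  fix x0
  have "bounded (f ` {x. f x \<le> f x0})"
    using assms by (auto simp: locally_bounded_def compact_sublevels_def)
  then have "bdd_below (f ` {x. f x \<le> f x0})" by (rule bounded_imp_bdd_below)
  then obtain m where "\<And>x. f x \<le> f x0 \<Longrightarrow> m \<le> f x" by (auto simp: bdd_below_def)
  then have "min m (f x0) \<le> f x" for x by (meson linear min.coboundedI1 min.coboundedI2)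
  then show ?thesis by (auto simp: bdd_below_def)
qed

text \<open>Outside the compact set \<open>{\<delta> F - G \<le> r}\<close> one has \<open>exp G < exp (- r) exp (\<delta> F)\<close>, and \<open>r\<close> can be
  chosen to make this \<open>\<epsilon> exp (\<delta> (F - m))\<close>; on the compact set, \<open>G\<close> is bounded
  because \<open>F\<close> and \<open>\<delta> F - G\<close> are.\<close>

lemma exp_cost_small:
  fixes F G :: "'a::topological_space \<Rightarrow> real"
  assumes lb: "locally_bounded F" "locally_bounded (\<lambda>x. \<delta> * F x - G x)"
    and cs: "compact_sublevels (\<lambda>x. \<delta> * F x - G x)" and "0 < \<delta>" "0 < \<epsilon>"
  shows "\<exists>c. \<forall>x. exp (G x) \<le> \<epsilon> * exp (\<delta> * (F x - m)) + c"
proof -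
  define r where "r = \<delta> * m - ln \<epsilon>"
  let ?K = "{x. \<delta> * F x - G x \<le> r}"
  have "compact ?K" using cs by (simp add: compact_sublevels_def)
  then have "bounded (F ` ?K)" "bounded ((\<lambda>x. \<delta> * F x - G x) ` ?K)"
    using lb by (auto simp: locally_bounded_def)
  then obtain b1 b2 where b1: "\<And>x. x \<in> ?K \<Longrightarrow> \<bar>F x\<bar> \<le> b1" and b2: "\<And>x. x \<in> ?K \<Longrightarrow> \<bar>\<delta> * F x - G x\<bar> \<le> b2"
    by (auto simp: bounded_iff)
  have "exp (G x) \<le> \<epsilon> * exp (\<delta> * (F x - m)) + exp (\<delta> * b1 + b2)" for x
  proof (cases "x \<in> ?K")
    case True
    have "\<delta> * F x \<le> \<delta> * b1" using b1[OF True] \<open>0 < \<delta>\<close> by (intro mult_left_mono) auto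
    then have "exp (G x) \<le> exp (\<delta> * b1 + b2)" using b2[OF True] by auto
    moreover have "0 \<le> \<epsilon> * exp (\<delta> * (F x - m))" using \<open>0 < \<epsilon>\<close> by simp
    ultimately show ?thesis by linarith
  next
    case False
    then have "G x \<le> ln \<epsilon> + \<delta> * (F x - m)" by (simp add: r_def algebra_simps)
    then have "exp (G x) \<le> exp (ln \<epsilon> + \<delta> * (F x - m))" by simp
    also have "\<dots> = \<epsilon> * exp (\<delta> * (F x - m))" using \<open>0 < \<epsilon>\<close> by (simp add: exp_add)
    finally show ?thesis by (simp add: add_increasing2)
  qed
  then show ?thesis by blast
qed

lemma exp_sublevel_subset:
  fixes F :: "'a \<Rightarrow> real"
  assumes "0 < \<delta>"
  shows "\<exists>r. {x. exp (\<delta> * (F x - m)) \<le> R} \<subseteq> {x. F x \<le> r}"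
proof (cases "0 < R")
  case True
  have "F x \<le> m + ln R / \<delta>" if "exp (\<delta> * (F x - m)) \<le> R" for x
  proof -
    have "\<delta> * (F x - m) \<le> ln R" using that True by (simp add: ln_ge_iff)
    then show ?thesis using \<open>0 < \<delta>\<close> by (simp add: field_simps)
  qed
  then show ?thesis by blast
next
  case False
  then have "\<not> exp (\<delta> * (F x - m)) \<le> R" for x
    by (meson exp_gt_zero less_le_trans)
  then show ?thesis by auto
qed

lemma integrable_exp_cost_weight:
  assumes [measurable]: "F \<in> borel_measurable lam" "G \<in> borel_measurable lam"
    and fin: "(\<integral>\<^sup>+x. ennreal (exp (G x)) \<partial>gibbs lam (\<lambda>x. (1 - \<delta>) * F x)) < \<infinity>"
  shows "integrable (gibbs lam F) (\<lambda>x. exp (G x) * exp (\<delta> * (F x - m)))"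
proof (rule integrableI_nonneg)
  have "(\<integral>\<^sup>+x. ennreal (exp (G x) * exp (\<delta> * (F x - m))) \<partial>gibbs lam F)
      = (\<integral>\<^sup>+x. ennreal (exp (- F x)) * ennreal (exp (G x) * exp (\<delta> * (F x - m))) \<partial>lam)"
    unfolding gibbs_def by (subst nn_integral_density) auto
  also have "\<dots> = (\<integral>\<^sup>+x. ennreal (exp (- \<delta> * m)) * (ennreal (exp (- ((1 - \<delta>) * F x))) * ennreal (exp (G x))) \<partial>lam)"
    by (intro nn_integral_cong) (simp add: ennreal_mult[symmetric] exp_add[symmetric] algebra_simps)
  also have "\<dots> = ennreal (exp (- \<delta> * m)) * (\<integral>\<^sup>+x. ennreal (exp (- ((1 - \<delta>) * F x))) * ennreal (exp (G x)) \<partial>lam)"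
    by (rule nn_integral_cmult) measurable
  also have "(\<integral>\<^sup>+x. ennreal (exp (- ((1 - \<delta>) * F x))) * ennreal (exp (G x)) \<partial>lam)
      = (\<integral>\<^sup>+x. ennreal (exp (G x)) \<partial>gibbs lam (\<lambda>x. (1 - \<delta>) * F x))"
    unfolding gibbs_def by (subst nn_integral_density) auto
  finally show "(\<integral>\<^sup>+x. ennreal (exp (G x) * exp (\<delta> * (F x - m))) \<partial>gibbs lam F) < \<infinity>"
    using fin by (simp add: ennreal_mult_less_top)
qed (auto simp: gibbs_def)

section \<open>Exponential decay of the Sinkhorn marginals\<close>

theorem corollary4p11:
  fixes lam :: "'a::polish_space measure" and nu :: "'b::polish_space measure"
    and U :: "'a \<Rightarrow> real" and V :: "'b \<Rightarrow> real" and W :: "'a \<Rightarrow> 'b \<Rightarrow> real"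
    and \<delta> :: real
    and r\<^sub>\<phi> :: "'a \<Rightarrow> 'a \<Rightarrow> real" and r\<^sub>\<psi> :: "'b \<Rightarrow> 'b \<Rightarrow> real"
    and \<phi> :: "'a \<Rightarrow> real" and \<psi> :: "'b \<Rightarrow> real"
  assumes "locally_compact_space (euclidean :: 'a topology)"
    and "locally_compact_space (euclidean :: 'b topology)"
    and "sets lam = sets borel" and "sets nu = sets borel"
    and "\<And>K. compact K \<Longrightarrow> emeasure lam K < \<infinity>"
    and "\<And>K. compact K \<Longrightarrow> emeasure nu K < \<infinity>"
    and "U \<in> borel_measurable borel" and "V \<in> borel_measurable borel"
    and "case_prod W \<in> borel_measurable (borel \<Otimes>\<^sub>M borel)"
    and "prob_space (gibbs lam U)" and "prob_space (gibbs nu V)"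
    and "kernel_Q nu W \<in> borel \<rightarrow>\<^sub>M prob_algebra borel"
    and "\<exists>P \<in> couplings (gibbs lam U) (gibbs nu V).
           finite_relative_entropy P (joint (gibbs lam U) nu (kernel_Q nu W))"
    and "locally_bounded U" and "locally_bounded V" and "locally_bounded (case_prod W)"
    and "\<exists>C. AE (x, y) in lam \<Otimes>\<^sub>M nu. \<bar>exp (- W x y)\<bar> \<le> C"
    and "compact_sublevels U" and "compact_sublevels V"
    and "0 < \<delta>" and "\<delta> \<le> 1" and "condition_H \<delta> lam nu U V W"
    and "semi_metric r\<^sub>\<phi>" and "semi_metric r\<^sub>\<psi>"
    and "\<And>x\<^sub>1 x\<^sub>2. exp (\<delta> * U x\<^sub>1) + exp (\<delta> * U x\<^sub>2) \<ge> r\<^sub>\<phi> x\<^sub>1 x\<^sub>2"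
    and "\<And>y\<^sub>1 y\<^sub>2. exp (\<delta> * V y\<^sub>1) + exp (\<delta> * V y\<^sub>2) \<ge> r\<^sub>\<psi> y\<^sub>1 y\<^sub>2"
    and "\<phi> = (\<lambda>x. exp (\<delta> * (U x - (INF x'. U x'))))"
    and "\<psi> = (\<lambda>y. exp (\<delta> * (V y - (INF y'. V y'))))"
  shows "\<exists>n\<^sub>0 \<rho> c\<^sub>u c\<^sub>v. 1 \<le> n\<^sub>0 \<and> 0 \<le> \<rho> \<and> \<rho> < 1 \<and> 0 \<le> c\<^sub>u \<and> 0 \<le> c\<^sub>v \<and>
    (\<forall>n\<ge>n\<^sub>0.
      transport r\<^sub>\<psi> (sinkhorn_pi_even lam nu U V W n) (gibbs nu V)
        \<le> ennreal (c\<^sub>v * \<rho> ^ (n - n\<^sub>0))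
           * tv_norm_diff \<psi> (sinkhorn_pi_even lam nu U V W n\<^sub>0) (gibbs nu V) \<and>
      transport r\<^sub>\<phi> (sinkhorn_pi_odd lam nu U V W n) (gibbs lam U)
        \<le> ennreal (c\<^sub>u * \<rho> ^ (n - n\<^sub>0))
           * tv_norm_diff \<phi> (sinkhorn_pi_odd lam nu U V W n\<^sub>0) (gibbs lam U))"
proof -
  note sl[measurable_cong] = assms(3) and sn[measurable_cong] = assms(4)
  note [measurable] = assms(7,8,9)
  note H = \<open>condition_H \<delta> lam nu U V W\<close>[unfolded condition_H_def]
  let ?M = "gibbs lam U" and ?N = "gibbs nu V"
  have sM[measurable_cong]: "sets ?M = sets borel" and sN[measurable_cong]: "sets ?N = sets borel"
    using sl sn by (simp_all add: gibbs_def)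
  have Wx[measurable]: "W x \<in> borel_measurable borel" for x
  proof -
    have "(\<lambda>y. case_prod W (x, y)) \<in> borel_measurable borel" by measurable
    then show ?thesis by simp
  qed
  have Wy[measurable]: "(\<lambda>x. W x y) \<in> borel_measurable borel" for y
  proof -
    have "(\<lambda>x. case_prod W (x, y)) \<in> borel_measurable borel" by measurable
    then show ?thesis by simp
  qed
  obtain C0 where C0: "AE z in lam \<Otimes>\<^sub>M nu. \<bar>exp (- W (fst z) (snd z))\<bar> \<le> C0"
    using assms(17) by (auto simp: case_prod_beta')
  interpret lam: sigma_finite_measure lam
    by (rule sigma_finite_of_gibbs[OF _ assms(10)]) measurable
  interpret nu: sigma_finite_measure nu
    by (rule sigma_finite_of_gibbs[OF _ assms(11)]) measurable
  interpret prod: pair_sigma_finite lam nu ..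
  have bound: "AE x in ?M. AE y in ?N. exp (- W x y) \<le> max 1 C0"
  proof -
    have "AE x in lam. AE y in nu. exp (- W x y) \<le> C0"
      using prod.AE_pair[OF C0] by simp
    then have "AE x in lam. AE y in ?N. exp (- W x y) \<le> max 1 C0"
    proof eventually_elim
      case (elim x)
      then have "AE y in nu. exp (- W x y) \<le> max 1 C0" by eventually_elim simp
      then show ?case by (rule AE_gibbs[rotated]) measurable
    qed
    then show ?thesis by (rule AE_gibbs[rotated]) measurable
  qed
  have bU: "bdd_below (range U)" and bV: "bdd_below (range V)"
    by (rule bdd_below_of_compact_sublevels, rule assms, rule assms)+
  \<comment> \<open>The reference probabilities \<open>\<lambda>\<^sub>U\<close> and \<open>\<nu>\<^sub>V\<close> with cost \<open>W\<close>; \<open>max 1\<close> makes the logarithm of the bound nonnegative.\<close>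
  interpret weighted_cost ?M ?N W "max 1 C0" \<phi> \<psi>
  proof (intro weighted_cost.intro coupled_cost.intro weighted_cost_axioms.intro)
    show "prob_space ?M" "prob_space ?N" by fact+
    show "case_prod W \<in> borel_measurable (?M \<Otimes>\<^sub>M ?N)" by measurable
    show "AE x in ?M. AE y in ?N. exp (- W x y) \<le> max 1 C0" by (rule bound)
    show "integrable ?N (\<lambda>y. W x y)" for x using H by blast
    show "integrable ?M (\<lambda>x. W x y)" for y using H by blast
    show "\<phi> \<in> borel_measurable ?M" "\<psi> \<in> borel_measurable ?N"
      unfolding assms(27,28) by measurable
    show "1 \<le> \<phi> x" for x
      using cINF_lower[OF bU, of x] \<open>0 < \<delta>\<close> by (simp add: assms(27))
    show "1 \<le> \<psi> y" for y
      using cINF_lower[OF bV, of y] \<open>0 < \<delta>\<close> by (simp add: assms(28))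
    interpret M: prob_space ?M by fact
    interpret N: prob_space ?N by fact
    have a: "cost_V nu V W \<in> borel_measurable lam"
      unfolding cost_V_def by measurable
    have b: "cost_U lam U W \<in> borel_measurable nu"
      unfolding cost_U_def by measurable
    have finV: "(\<integral>\<^sup>+x. ennreal (exp (cost_V nu V W x)) \<partial>gibbs lam (\<lambda>x. (1 - \<delta>) * U x)) < \<infinity>"
      and finU: "(\<integral>\<^sup>+y. ennreal (exp (cost_U lam U W y)) \<partial>gibbs nu (\<lambda>y. (1 - \<delta>) * V y)) < \<infinity>"
      using H by (simp_all only: max_less_iff_conj)
    have "integrable ?M (\<lambda>x. exp (cost_V nu V W x) * exp (\<delta> * (U x - m)))" for m
      by (rule integrable_exp_cost_weight[OF _ a finV]) measurable
    then show "integrable ?M (\<lambda>x. exp (\<integral>y. W x y \<partial>?N) * \<phi> x)"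
      unfolding assms(27) cost_V_def .
    have "integrable ?N (\<lambda>y. exp (cost_U lam U W y) * exp (\<delta> * (V y - m)))" for m
      by (rule integrable_exp_cost_weight[OF _ b finU]) measurable
    then show "integrable ?N (\<lambda>y. exp (\<integral>x. W x y \<partial>?M) * \<psi> y)"
      unfolding assms(28) cost_U_def .
    have lV: "locally_bounded (\<lambda>x. \<delta> * U x - cost_V nu V W x)"
      "compact_sublevels (\<lambda>x. \<delta> * U x - cost_V nu V W x)"
      and lU: "locally_bounded (\<lambda>y. \<delta> * V y - cost_U lam U W y)"
      "compact_sublevels (\<lambda>y. \<delta> * V y - cost_U lam U W y)"
      using H by blast+
    show "\<exists>c. \<forall>x. exp (\<integral>y. W x y \<partial>?N) \<le> \<epsilon> * \<phi> x + c" if "0 < \<epsilon>" for \<epsilon>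
      using exp_cost_small[OF assms(14) lV assms(20) that] unfolding assms(27) cost_V_def .
    show "\<exists>c. \<forall>y. exp (\<integral>x. W x y \<partial>?M) \<le> \<epsilon> * \<psi> y + c" if "0 < \<epsilon>" for \<epsilon>
      using exp_cost_small[OF assms(15) lU assms(20) that] unfolding assms(28) cost_U_def .
    show "\<exists>w. \<forall>x y. \<phi> x \<le> R \<longrightarrow> \<psi> y \<le> R \<longrightarrow> W x y \<le> w" for R
    proof -
      obtain s where s: "{x. \<phi> x \<le> R} \<subseteq> {x. U x \<le> s}"
        using exp_sublevel_subset[OF assms(20), of U "INF x. U x" R] unfolding assms(27) by blast
      obtain t where t: "{y. \<psi> y \<le> R} \<subseteq> {y. V y \<le> t}"
        using exp_sublevel_subset[OF assms(20), of V "INF y. V y" R] unfolding assms(28) by blast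
      have "compact ({x. U x \<le> s} \<times> {y. V y \<le> t})"
        using assms(18,19) by (intro compact_Times) (auto simp: compact_sublevels_def)
      then have "bounded (case_prod W ` ({x. U x \<le> s} \<times> {y. V y \<le> t}))"
        using assms(16) by (simp add: locally_bounded_def)
      then obtain w where w: "\<forall>z \<in> case_prod W ` ({x. U x \<le> s} \<times> {y. V y \<le> t}). norm z \<le> w"
        by (auto simp only: bounded_iff)
      have "W x y \<le> w" if "\<phi> x \<le> R" "\<psi> y \<le> R" for x y
      proof -
        have "(x, y) \<in> {x. U x \<le> s} \<times> {y. V y \<le> t}" using s t that by blast
        then have "norm (case_prod W (x, y)) \<le> w" using w by blast
        then show ?thesis by simp
      qed
      then show ?thesis by blast
    qed
  qed simp
  have pot_measurable: "pot n \<in> borel_measurable borel" and dual_measurable: "dual n \<in> borel_measurable borel" for n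
    using proper_dual[of n] unfolding proper_transform_def
      measurable_cong_sets[OF sM refl] measurable_cong_sets[OF sN refl] by simp_all
  have potentials_lam: "U \<in> borel_measurable lam" "pot n \<in> borel_measurable lam"
      "(\<lambda>x. W x y) \<in> borel_measurable lam" for n y
    unfolding measurable_cong_sets[OF sl refl] by fact+
  have potentials_nu: "V \<in> borel_measurable nu" "dual n \<in> borel_measurable nu"
      "W x \<in> borel_measurable nu" for n x
    unfolding measurable_cong_sets[OF sn refl] by fact+
  have Q: "prob_space (kernel_Q nu W x)" for x
    using measurable_space[OF assms(12), of x] by (simp add: space_prob_algebra)
  \<comment> \<open>The conventional values at points of divergence are the same on both sides, so these identities hold at every point.\<close>
  have UV: "sinkhorn_U lam nu U V W (2 * n) = (\<lambda>x. U x + pot n x)"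
    "sinkhorn_V lam nu U V W (2 * n + 1) = (\<lambda>y. V y + dual n y)" for n
  proof -
    have V: "sinkhorn_V lam nu U V W (2 * n + 1) = (\<lambda>y. V y + dual n y)"
      if "sinkhorn_U lam nu U V W (2 * n) = (\<lambda>x. U x + pot n x)" for n
      unfolding sinkhorn_V_odd that kernel_R_eq_kernel_Q
      by (subst kernel_apply_gibbs[OF potentials_lam]) (simp add: dual_potential_def log_integral_transform_def)
    have U: "sinkhorn_U lam nu U V W (2 * n) = (\<lambda>x. U x + pot n x)" for n
    proof (induction n)
      case 0
      then show ?case by (simp add: sinkhorn_U_def)
    next
      case (Suc n)
      have "sinkhorn_V lam nu U V W (2 * Suc n) = (\<lambda>y. V y + dual n y)"
        using sinkhorn_V_even[of lam nu U V W n] V[OF Suc] by simp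
      then show ?case
        unfolding sinkhorn_U_even[OF Q]
        by (simp only:, subst kernel_apply_gibbs[OF potentials_nu]) (simp add: dual_potential_def log_integral_transform_def)
    qed
    show "sinkhorn_U lam nu U V W (2 * n) = (\<lambda>x. U x + pot n x)"
      "sinkhorn_V lam nu U V W (2 * n + 1) = (\<lambda>y. V y + dual n y)"
      using U V[OF U] by auto
  qed
  interpret S: weighted_cost ?N ?M "\<lambda>y x. W x y" "max 1 C0" \<psi> \<phi> by (rule swapped_weighted)
  have even: "sinkhorn_pi_even lam nu U V W (Suc n)
      = density ?N (\<lambda>y. ennreal (exp (dual (Suc n) y - dual n y)))" for n
  proof -
    have V': "sinkhorn_V lam nu U V W (2 * Suc n) = (\<lambda>y. V y + dual n y)"
      using sinkhorn_V_even[of lam nu U V W n] UV(2)[of n] by simp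
    have Z: "kernel_apply (kernel_Q nu W) (\<lambda>y. exp (- (V y + dual n y))) x
        = (\<integral>z. exp (- W x z - dual n z) \<partial>?N)" for x
      by (rule kernel_apply_gibbs) (rule potentials_nu)+
    have "sinkhorn_S_even lam nu U V W (Suc n)
        = (\<lambda>x. density ?N (\<lambda>y. ennreal (exp (- W x y - dual n y) / (\<integral>z. exp (- W x z - dual n z) \<partial>?N))))"
      unfolding sinkhorn_S_even_def Let_def V' Z
      by (intro ext normalised_kernel_gibbs integral_nonneg_AE potentials_nu) simp
    then show ?thesis
      unfolding sinkhorn_pi_even_def using bind_normalised_kernel[OF proper_potential proper_dual] by simp
  qed
  have odd: "sinkhorn_pi_odd lam nu U V W n
      = density ?M (\<lambda>x. ennreal (exp (pot (Suc n) x - pot n x)))" for n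
  proof -
    have U': "sinkhorn_U lam nu U V W (2 * n + 1) = (\<lambda>x. U x + pot n x)"
      using sinkhorn_U_odd[of lam nu U V W n] UV(1)[of n] by simp
    have Z: "kernel_apply (kernel_Q lam (\<lambda>y x. W x y)) (\<lambda>x. exp (- (U x + pot n x))) y
        = (\<integral>z. exp (- W z y - pot n z) \<partial>?M)" for y
      by (rule kernel_apply_gibbs) (rule potentials_lam)+
    have "sinkhorn_S_odd lam nu U V W n
        = (\<lambda>y. density ?M (\<lambda>x. ennreal (exp (- W x y - pot n x) / (\<integral>z. exp (- W z y - pot n z) \<partial>?M))))"
      unfolding sinkhorn_S_odd_def Let_def U' kernel_R_eq_kernel_Q Z
      by (intro ext normalised_kernel_gibbs integral_nonneg_AE potentials_lam) simp
    then show ?thesis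
      unfolding sinkhorn_pi_odd_def using S.bind_normalised_kernel[OF proper_dual proper_potential] by simp
  qed
  have mass_N: "prob_space (density ?N (\<lambda>y. ennreal (exp (dual (Suc n) y - dual n y))))" for n
    by (rule S.prob_space_round_trip_density[OF proper_potential proper_dual])
  have mass_M: "prob_space (density ?M (\<lambda>x. ennreal (exp (pot (Suc n) x - pot n x))))" for n
    by (rule prob_space_round_trip_density[OF proper_dual proper_potential])
  obtain \<rho> c where rho: "0 \<le> \<rho>" "\<rho> < 1" "0 \<le> c"
    and decN: "\<And>n. (\<integral>\<^sup>+y. ennreal (\<psi> y) * ennreal \<bar>exp (dual (Suc n) y - dual n y) - 1\<bar> \<partial>?N)
       \<le> ennreal (c * \<rho> ^ n) * (\<integral>\<^sup>+y. ennreal (\<psi> y) * ennreal \<bar>exp (dual (Suc 0) y - dual 0 y) - 1\<bar> \<partial>?N)"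
    and decM: "\<And>n. (\<integral>\<^sup>+x. ennreal (\<phi> x) * ennreal \<bar>exp (pot (Suc (Suc n)) x - pot (Suc n) x) - 1\<bar> \<partial>?M)
       \<le> ennreal (c * \<rho> ^ n) * (\<integral>\<^sup>+x. ennreal (\<phi> x) * ennreal \<bar>exp (pot (Suc 1) x - pot 1 x) - 1\<bar> \<partial>?M)"
    using deviation_decay unfolding numeral_2_eq_2 One_nat_def by blast
  \<comment> \<open>The semi-metrics are bounded in terms of \<open>exp (\<delta> U)\<close>, which is \<open>\<phi>\<close> up to this factor.\<close>
  let ?u = "exp (\<delta> * (INF x. U x))" and ?v = "exp (\<delta> * (INF y. V y))"
  have T1: "transport r\<^sub>\<psi> (sinkhorn_pi_even lam nu U V W (Suc n)) ?N
      \<le> ennreal (?v * (c * \<rho> ^ n)) * tv_norm_diff \<psi> (sinkhorn_pi_even lam nu U V W 1) ?N" for n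
    unfolding even One_nat_def
  proof (rule transport_le_tv_norm_diff_if_decay[OF assms(11) ratio_measurable(2) _ mass_N ratio_measurable(2) _ mass_N])
    show "case_prod r\<^sub>\<psi> \<in> borel_measurable (?N \<Otimes>\<^sub>M ?N)" "r\<^sub>\<psi> y y = 0" for y
      using assms(24) by (auto simp: semi_metric_def cong: measurable_cong_sets sets_pair_measure_cong)
    show "r\<^sub>\<psi> x y \<le> ?v * \<psi> x + ?v * \<psi> y" for x y
      using assms(26)[of x y] unfolding assms(28) exp_add[symmetric] by (simp add: algebra_simps)
  qed (use rho decN order_trans[OF zero_le_one \<psi>_ge_1] in auto)
  have T2: "transport r\<^sub>\<phi> (sinkhorn_pi_odd lam nu U V W (Suc n)) ?M
      \<le> ennreal (?u * (c * \<rho> ^ n)) * tv_norm_diff \<phi> (sinkhorn_pi_odd lam nu U V W 1) ?M" for n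
    unfolding odd
  proof (rule transport_le_tv_norm_diff_if_decay[OF assms(10) ratio_measurable(1) _ mass_M ratio_measurable(1) _ mass_M])
    show "case_prod r\<^sub>\<phi> \<in> borel_measurable (?M \<Otimes>\<^sub>M ?M)" "r\<^sub>\<phi> y y = 0" for y
      using assms(23) by (auto simp: semi_metric_def cong: measurable_cong_sets sets_pair_measure_cong)
    show "r\<^sub>\<phi> x y \<le> ?u * \<phi> x + ?u * \<phi> y" for x y
      using assms(25)[of x y] unfolding assms(27) exp_add[symmetric] by (simp add: algebra_simps)
  qed (use rho decM order_trans[OF zero_le_one \<phi>_ge_1] in auto)
  show ?thesis
  \<comment> \<open>The density \<open>exp (v\<^sub>n - v\<^bsub>n-1\<^esub>)\<close> of \<open>\<pi>\<^bsub>2n\<^esub>\<close> makes sense from \<open>n = 1\<close> on.\<close>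
  proof (rule exI[of _ 1], rule exI[of _ \<rho>], rule exI[of _ "?u * c"], rule exI[of _ "?v * c"],
      intro conjI allI impI)
    fix n :: nat assume "1 \<le> n"
    then obtain m where n: "n = Suc m" by (cases n) auto
    show "transport r\<^sub>\<psi> (sinkhorn_pi_even lam nu U V W n) ?N
        \<le> ennreal (?v * c * \<rho> ^ (n - 1)) * tv_norm_diff \<psi> (sinkhorn_pi_even lam nu U V W 1) ?N"
      using T1[of m] by (simp add: n mult.assoc)
    show "transport r\<^sub>\<phi> (sinkhorn_pi_odd lam nu U V W n) ?M
        \<le> ennreal (?u * c * \<rho> ^ (n - 1)) * tv_norm_diff \<phi> (sinkhorn_pi_odd lam nu U V W 1) ?M"
      using T2[of m] by (simp add: n mult.assoc)
  qed (use rho in auto)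
qed

end
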